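(* Let $k$ be a positive integer and let $XES(k)$ be an extended Erdős–Szekeres point set. Then $\mathcal{H}(XES(k)) \cong \mathcal{G}(XES(k))$, i.e. the hypergraph $\mathcal{H}(XES(k))$ is isomorphic to the graph $\mathcal{G}(XES(k))$ (regarded as a hypergraph whose hyperedges are the 2-element edges). Further, $\dim(XES(k)) = k+1$.
   Context: All point sets are finite sets of points in $\mathbb{R}^2$ in general position (no three on a line). For a finite point set $X\subseteq\mathbb{R}^2$ put $\mathscr{L}(A)=\operatorname{conv}(A)\cap X$ for $A\subseteq X$. A subset $A\subseteq X$ is closed if $\mathscr{L}(A)=A$; $\mathcal{C}$ denotes the family of closed sets, and $\mathcal{L}=(\mathcal{C},\subseteq)$ is the lattice of closed sets. The pair $(X,\mathscr{L})$ is a convex geometry, abbreviated $X$. Copoints: $A\in\mathcal{C}$ is a copoint if there is exactly one $B\in\mathcal{C}$ with $A\subset B$ and $|B\setminus A|=1$; the unique element of $B\setminus A$ is denoted $\alpha(A)$, and $A$ is said to be attached to $\alpha(A)$. $M(X)$ is the set of copoints. Order dimension: the order dimension of a poset $P$ is the least positive integer $t$ such that $P$ is the intersection of $t$ linear extensions of $P$; $\dim(X)$ denotes the order dimension of the lattice $\mathcal{L}$ of closed sets of $X$. Hypergraph $\mathcal{H}(X)$: a critical pair of a poset $(Y,\le)$ is an ordered pair $(A,B)$ of incomparable elements such that for all $U,D\in Y$, $U>B$ implies $U>A$, and $D<A$ implies $D<B$. The critical digraph of a poset has the critical pairs as vertices and a directed edge $(A,B)\to(C,D)$ whenever $C\le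 B$. $\mathcal{H}(X)$ is the hypergraph whose vertices are the critical pairs of $\mathcal{L}$ and whose hyperedges are the (vertex sets of) minimal directed cycles of the critical digraph of $\mathcal{L}$, a cycle being minimal if no proper subset of its vertex set is the vertex set of a directed cycle. Graph $\mathcal{G}(X)$: vertex set $M(X)$, with $AB$ an edge if and only if $\alpha(A)\in B$ and $\alpha(B)\in A$. Composition: for planar point sets $L$ and $M$, a composition of $L$ and $M$ is a point set consisting of $L$ together with a translate of $M$ (again called $M$) such that (1) every point of $M$ has greater first coordinate than every point of $L$; (2) the slope of any line connecting a point of $L$ to a point of $M$ is greater than the slope of any line connecting two points of $L$ or two points of $M$ (lines involved are non-vertical). Erdős–Szekeres sets: for every positive integer $k$, $ES(0,k)$ and $ES(k,0)$ are singletons. For $i,j\ge 1$, $ES(i,j)$ is a composition of $ES(i-1,j)$ and $ES(i,j-1)$ (so it has $\binom{i+j}{i}$ points). $XES(k)$ is a composition of $ES(0,k),ES(1,k-1),\dots,ES(k,0)$, where the compositions are performed in order from left to right; it has $2^k$ points. *)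

theory Defs
  imports "HOL-Analysis.Analysis" "Graph_Theory.Graph_Theory"
begin

section \<open>Posets\<close>

text \<open>A poset is given by its ground set \<open>Y\<close> and its (weak) order, a relation \<open>r\<close> on \<open>Y\<close>.\<close>

definition linear_extension :: "'a set \<Rightarrow> 'a rel \<Rightarrow> 'a rel \<Rightarrow> bool" where
  "linear_extension Y r s \<longleftrightarrow> linear_order_on Y s \<and> r \<subseteq> s"

definition order_dimension :: "'a set \<Rightarrow> 'a rel \<Rightarrow> nat" where
  "order_dimension Y r = (LEAST t. t > 0 \<and>
     (\<exists>s. (\<forall>i<t. linear_extension Y r (s i)) \<and> r = (\<Inter>i<t. s i)))"

definition critical_pairs :: "'a set \<Rightarrow> 'a rel \<Rightarrow> ('a \<times> 'a) set" where
  "critical_pairs Y r = {(A, B). A \<in> Y \<and> B \<in> Y \<and> (A, B) \<notin> r \<and> (B, A) \<notin> r \<and>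
     (\<forall>U\<in>Y. (B, U) \<in> r \<and> U \<noteq> B \<longrightarrow> (A, U) \<in> r \<and> U \<noteq> A) \<and>
     (\<forall>D\<in>Y. (D, A) \<in> r \<and> D \<noteq> A \<longrightarrow> (D, B) \<in> r \<and> D \<noteq> B)}"

definition critical_digraph :: "'a set \<Rightarrow> 'a rel \<Rightarrow> ('a \<times> 'a) pair_pre_digraph" where
  "critical_digraph Y r = \<lparr>
     pverts = critical_pairs Y r,
     parcs = {((A, B), (C, D)) | A B C D.
       (A, B) \<in> critical_pairs Y r \<and> (C, D) \<in> critical_pairs Y r \<and> (C, B) \<in> r}\<rparr>"


section \<open>Hypergraphs\<close>

text \<open>A hypergraph is the pair of its vertex set and its set of hyperedges.\<close>

type_synonym 'a hypergraph = "'a set \<times> 'a set set"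

definition hypergraph_iso :: "'a hypergraph \<Rightarrow> 'b hypergraph \<Rightarrow> bool" where
  "hypergraph_iso H K \<longleftrightarrow>
     (\<exists>f. bij_betw f (fst H) (fst K) \<and> (\<lambda>e. f ` e) ` snd H = snd K)"

text \<open>A cycle in \<open>Graph_Theory\<close> is a nonempty list of arcs, whose vertices are the tails of its arcs.\<close>

definition cycle_vertex_sets :: "'a pair_pre_digraph \<Rightarrow> 'a set set" where
  "cycle_vertex_sets G = {fst ` set p | p. pre_digraph.cycle (with_proj G) p}"

definition minimal_cycle_vertex_sets :: "'a pair_pre_digraph \<Rightarrow> 'a set set" where
  "minimal_cycle_vertex_sets G =
     {S \<in> cycle_vertex_sets G. \<not> (\<exists>T \<in> cycle_vertex_sets G. T \<subset> S)}"


section \<open>The convex geometry of a planar point set\<close>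

definition planar_point_set :: "(real^2) set \<Rightarrow> bool" where
  "planar_point_set X \<longleftrightarrow> finite X \<and> (\<forall>T\<subseteq>X. card T = 3 \<longrightarrow> \<not> collinear T)"

definition geom_closure :: "(real^2) set \<Rightarrow> (real^2) set \<Rightarrow> (real^2) set" where
  "geom_closure X A = convex hull A \<inter> X"

definition closed_sets :: "(real^2) set \<Rightarrow> (real^2) set set" where
  "closed_sets X = {A. A \<subseteq> X \<and> geom_closure X A = A}"

definition closed_order :: "(real^2) set \<Rightarrow> (real^2) set rel" where
  "closed_order X = {(A, B). A \<in> closed_sets X \<and> B \<in> closed_sets X \<and> A \<subseteq> B}"

definition point_cover :: "(real^2) set \<Rightarrow> (real^2) set \<Rightarrow> (real^2) set \<Rightarrow> bool" where
  "point_cover X A B \<longleftrightarrow> B \<in> closed_sets X \<and> A \<subset> B \<and> card (B - A) = 1"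

definition copoints :: "(real^2) set \<Rightarrow> (real^2) set set" where
  "copoints X = {A \<in> closed_sets X. \<exists>!B. point_cover X A B}"

definition attach_point :: "(real^2) set \<Rightarrow> (real^2) set \<Rightarrow> real^2" where
  "attach_point X A = the_elem ((THE B. point_cover X A B) - A)"

definition geom_dim :: "(real^2) set \<Rightarrow> nat" where
  "geom_dim X = order_dimension (closed_sets X) (closed_order X)"

definition critical_hypergraph :: "(real^2) set \<Rightarrow> ((real^2) set \<times> (real^2) set) hypergraph" where
  "critical_hypergraph X =
     (critical_pairs (closed_sets X) (closed_order X),
      minimal_cycle_vertex_sets (critical_digraph (closed_sets X) (closed_order X)))"

definition copoint_graph :: "(real^2) set \<Rightarrow> (real^2) set hypergraph" where
  "copoint_graph X =
     (copoints X,
      {{A, B} | A B. A \<in> copoints X \<and> B \<in> copoints X \<and> A \<noteq> B \<and>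
         attach_point X A \<in> B \<and> attach_point X B \<in> A})"


section \<open>Compositions and extended Erdos-Szekeres sets\<close>

definition slope :: "real^2 \<Rightarrow> real^2 \<Rightarrow> real" where
  "slope p q = (q $ 2 - p $ 2) / (q $ 1 - p $ 1)"

text \<open>The slope condition presupposes that no line through two points of \<open>L\<close>, or through two
  points of \<open>M\<close>, is vertical; this is stated explicitly because division by zero is total.\<close>

definition composition :: "(real^2) set \<Rightarrow> (real^2) set \<Rightarrow> (real^2) set \<Rightarrow> bool" where
  "composition L M Z \<longleftrightarrow>
     planar_point_set L \<and> planar_point_set M \<and> planar_point_set Z \<and>
     inj_on (\<lambda>p. p $ 1) L \<and> inj_on (\<lambda>p. p $ 1) M \<and>
     (\<exists>v M'. M' = (\<lambda>p. p + v) ` M \<and> Z = L \<union> M' \<and>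
        (\<forall>l\<in>L. \<forall>m\<in>M'. l $ 1 < m $ 1) \<and>
        (\<forall>l\<in>L. \<forall>m\<in>M'.
           (\<forall>p\<in>L. \<forall>q\<in>L. p \<noteq> q \<longrightarrow> slope p q < slope l m) \<and>
           (\<forall>p\<in>M'. \<forall>q\<in>M'. p \<noteq> q \<longrightarrow> slope p q < slope l m)))"

text \<open>Compositions are not unique as point sets, so \<open>ES(i,j)\<close> and \<open>XES(k)\<close> are predicates:
  \<open>is_ES i j X\<close> says that \<open>X\<close> is one of the sets that may be called \<open>ES(i,j)\<close>.\<close>

inductive is_ES :: "nat \<Rightarrow> nat \<Rightarrow> (real^2) set \<Rightarrow> bool" where
  left: "k > 0 \<Longrightarrow> is_ES 0 k {p}"
| right: "k > 0 \<Longrightarrow> is_ES k 0 {p}"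
| comp: "i \<ge> 1 \<Longrightarrow> j \<ge> 1 \<Longrightarrow> is_ES (i - 1) j L \<Longrightarrow> is_ES i (j - 1) M \<Longrightarrow> composition L M X
    \<Longrightarrow> is_ES i j X"

text \<open>\<open>is_XES_upto k m X\<close>: \<open>X\<close> is a left-to-right composition of
  \<open>ES(0,k), ES(1,k-1), \<dots>, ES(m,k-m)\<close>.\<close>

inductive is_XES_upto :: "nat \<Rightarrow> nat \<Rightarrow> (real^2) set \<Rightarrow> bool" for k :: nat where
  first: "is_ES 0 k X \<Longrightarrow> is_XES_upto k 0 X"
| extend: "m < k \<Longrightarrow> is_XES_upto k m L \<Longrightarrow> is_ES (Suc m) (k - Suc m) M \<Longrightarrow> composition L M X
    \<Longrightarrow> is_XES_upto k (Suc m) X"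

definition is_XES :: "nat \<Rightarrow> (real^2) set \<Rightarrow> bool" where
  "is_XES k X \<longleftrightarrow> is_XES_upto k k X"

end

theory Submission
  imports Defs
begin

text \<open>Iterated compositions make \<open>X\<close> the leaves of a binary tree, and lines through a point \<open>p\<close>
  have smaller slope towards points that split off from \<open>p\<close> deeper in the tree. Hence the maximal
  closed sets missing \<open>p\<close> are the points above, or those below, a line through \<open>p\<close> whose slope
  separates the depths less than some \<open>n\<close> from the others. Such a set contains each subtree
  hanging off the path to \<open>p\<close> entirely or not at all, so a directed cycle must, at the first
  branching of its points, contain a copoint on either side that swallows the other side: these
  two form a 2-cycle. Since critical pairs correspond to copoints, this identifies the hypergraph
  with the copoint graph.

  For the dimension, colour an upper set of depth \<open>n\<close> at \<open>p\<close> by the number of left turns among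
  the first \<open>n\<close> steps to \<open>p\<close>, and a lower one by the number of right turns minus one. Adjacent
  copoints get different colours, the colours range over \<open>0, \<dots>, k\<close>, and each colour class can
  be reversed by one linear extension. Conversely, one point from each of the \<open>k + 1\<close> blocks gives
  \<open>k + 1\<close> points in convex position, and these need different linear extensions.\<close>

section \<open>Binary trees of points\<close>

datatype 'a btree = Tip 'a | Branch "'a btree" "'a btree"

abbreviation pts :: "'a btree \<Rightarrow> 'a set" where
  "pts \<equiv> set_btree"

text \<open>The order and slope conditions of a composition, imposed at every branching, so that the
  tree records the whole iterated construction.\<close>

fun steep :: "(real^2) btree \<Rightarrow> bool" where
  "steep (Tip x) \<longleftrightarrow> True"
| "steep (Branch l r) \<longleftrightarrow> steep l \<and> steep r \<and>
     (\<forall>p\<in>pts l. \<forall>q\<in>pts r. p $ 1 < q $ 1 \<and>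
        (\<forall>a\<in>pts l. \<forall>b\<in>pts l. a \<noteq> b \<longrightarrow> slope a b < slope p q) \<and>
        (\<forall>a\<in>pts r. \<forall>b\<in>pts r. a \<noteq> b \<longrightarrow> slope a b < slope p q))"

text \<open>For distinct points of a steep tree this is the depth of their lowest common ancestor;
  for \<open>p = q\<close> it is the depth of the leaf.\<close>

fun split_depth :: "'a btree \<Rightarrow> 'a \<Rightarrow> 'a \<Rightarrow> nat" where
  "split_depth (Tip x) p q = 0"
| "split_depth (Branch l r) p q =
     (if p \<in> pts l \<and> q \<in> pts l then Suc (split_depth l p q)
      else if p \<in> pts r \<and> q \<in> pts r then Suc (split_depth r p q) else 0)"

fun lefts :: "'a btree \<Rightarrow> nat \<Rightarrow> 'a \<Rightarrow> nat" where
  "lefts (Branch l r) (Suc n) p = (if p \<in> pts l then Suc (lefts l n p) else lefts r n p)"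
| "lefts _ _ _ = 0"

fun rights :: "'a btree \<Rightarrow> nat \<Rightarrow> 'a \<Rightarrow> nat" where
  "rights (Branch l r) (Suc n) p = (if p \<in> pts l then rights l n p else Suc (rights r n p))"
| "rights _ _ _ = 0"

text \<open>Identifies the block of a point: in the tree of \<open>XES(k)\<close> the points of
  \<open>ES(k - j, j)\<close> have value \<open>j\<close>, because the blocks hang to the right off
  the leftmost path, with \<open>ES(0, k)\<close> at its end.\<close>

fun initial_lefts :: "'a btree \<Rightarrow> 'a \<Rightarrow> nat" where
  "initial_lefts (Tip x) p = 0"
| "initial_lefts (Branch l r) p = (if p \<in> pts l then Suc (initial_lefts l p) else 0)"

section \<open>Slopes and splitting depths in steep trees\<close>

lemma finite_pts [simp]: "finite (pts T)"
  by (induction T) auto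

lemma pts_nonempty: "pts T \<noteq> {}"
  by (induction T) auto

lemma steep_disjoint: "steep (Branch l r) \<Longrightarrow> pts l \<inter> pts r = {}"
  by fastforce

lemma steep_fst_neq: "steep T \<Longrightarrow> p \<in> pts T \<Longrightarrow> q \<in> pts T \<Longrightarrow> p \<noteq> q \<Longrightarrow> p $ 1 \<noteq> q $ 1"
  by (induction T) force+

lemma slope_commute: "slope p q = slope q p"
  unfolding slope_def by (metis minus_diff_eq minus_divide_divide)

lemma split_depth_commute: "split_depth T p q = split_depth T q p"
  by (induction T) auto

lemma split_depth_less_size: "split_depth T p q < size T + 1"
  by (induction T) auto

lemma initial_lefts_less_size: "initial_lefts T p < size T + 1"
  by (induction T) auto

text \<open>At the branching where \<open>q\<close> leaves the path to \<open>p\<close>, both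
  \<open>p\<close> and \<open>q'\<close> lie on one side, and slopes within a side are smaller than
  slopes across.\<close>

lemma slope_less_if_split_depth_less:
  assumes "steep T" "p \<in> pts T" "q \<in> pts T" "q' \<in> pts T" "q \<noteq> p" "q' \<noteq> p"
    and "split_depth T p q < split_depth T p q'"
  shows "slope p q' < slope p q"
  using assms
proof (induction T)
  case (Branch l r)
  have disj: "pts l \<inter> pts r = {}"
    using Branch.prems(1) by (rule steep_disjoint)
  consider "p \<in> pts l" "q' \<in> pts l" | "p \<in> pts r" "q' \<in> pts r"
    using Branch.prems(7) by (auto split: if_splits)
  then show ?case
  proof cases
    case 1
    show ?thesis
    proof (cases "q \<in> pts l")
      case True
      then show ?thesis using 1 Branch by auto
    next
      case False
      then have "q \<in> pts r" using Branch.prems(3) by auto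
      then show ?thesis using 1 Branch.prems(1,6) by force
    qed
  next
    case 2
    show ?thesis
    proof (cases "q \<in> pts r")
      case True
      moreover have "p \<notin> pts l" using 2 disj by auto
      ultimately show ?thesis using 2 Branch by auto
    next
      case False
      then have "q \<in> pts l" using Branch.prems(3) by auto
      then have "slope p q' < slope q p" using 2 Branch.prems(1,6) by force
      then show ?thesis by (simp add: slope_commute)
    qed
  qed
qed auto

text \<open>Points leaving the path to \<open>p\<close> at the same depth lie in one sibling
  subtree, which is entirely left or entirely right of \<open>p\<close>.\<close>

lemma same_side_if_split_depth_eq:
  assumes "steep T" "p \<in> pts T" "q \<in> pts T" "q' \<in> pts T" "q \<noteq> p" "q' \<noteq> p"
    and "split_depth T p q = split_depth T p q'"
  shows "p $ 1 < q $ 1 \<longleftrightarrow> p $ 1 < q' $ 1"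
  using assms
proof (induction T)
  case (Branch l r)
  have disj: "pts l \<inter> pts r = {}"
    using Branch.prems(1) by (rule steep_disjoint)
  have less: "\<And>x y. x \<in> pts l \<Longrightarrow> y \<in> pts r \<Longrightarrow> x $ 1 < y $ 1"
    using Branch.prems(1) by auto
  show ?case
  proof (cases "p \<in> pts l")
    case True
    then have "p \<notin> pts r" using disj by auto
    then show ?thesis
      using True Branch less by (auto split: if_splits)
  next
    case False
    then have p: "p \<in> pts r" using Branch.prems(2) by auto
    then have "\<And>x. x \<in> pts l \<Longrightarrow> \<not> p $ 1 < x $ 1"
      using less by force
    then show ?thesis
      using False p Branch by (auto split: if_splits)
  qed
qed auto

subsection \<open>Counting turns\<close>

lemma lefts_eq_if_le_split_depth: "steep T \<Longrightarrow> n \<le> split_depth T p q \<Longrightarrow> lefts T n p = lefts T n q"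
proof (induction T arbitrary: n)
  case (Branch l r)
  have "pts l \<inter> pts r = {}"
    using Branch.prems(1) by (rule steep_disjoint)
  with Branch show ?case by (cases n) (auto split: if_splits)
qed auto

lemma rights_eq_if_le_split_depth: "steep T \<Longrightarrow> n \<le> split_depth T p q \<Longrightarrow> rights T n p = rights T n q"
proof (induction T arbitrary: n)
  case (Branch l r)
  have "pts l \<inter> pts r = {}"
    using Branch.prems(1) by (rule steep_disjoint)
  with Branch show ?case by (cases n) (auto split: if_splits)
qed auto

lemma lefts_mono: "m \<le> n \<Longrightarrow> lefts T m p \<le> lefts T n p"
proof (induction T arbitrary: m n)
  case (Branch l r)
  then show ?case by (cases m; cases n) auto
qed auto

text \<open>The step to \<open>p\<close> at the splitting depth goes left, since \<open>q\<close>
  goes right there, and it is counted once \<open>n\<close> exceeds that depth.\<close>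

lemma lefts_after_split:
  assumes "steep T" "p \<in> pts T" "q \<in> pts T" "p $ 1 < q $ 1" "split_depth T p q < n"
  shows "lefts T (split_depth T p q) p < lefts T n p"
  using assms
proof (induction T arbitrary: n)
  case (Branch l r)
  have disj: "pts l \<inter> pts r = {}"
    using Branch.prems(1) by (rule steep_disjoint)
  have less: "\<And>x y. x \<in> pts l \<Longrightarrow> y \<in> pts r \<Longrightarrow> x $ 1 < y $ 1"
    using Branch.prems(1) by auto
  obtain n' where n: "n = Suc n'"
    using Branch.prems(5) by (cases n) auto
  have "\<not> (q \<in> pts l \<and> p \<in> pts r)"
    using less[of q p] Branch.prems(4) by (meson less_asym)
  then consider "p \<in> pts l" "q \<in> pts l" | "p \<in> pts r" "q \<in> pts r" | "p \<in> pts l" "q \<in> pts r"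
    using Branch.prems(2,3) unfolding btree.set by blast
  then show ?case
    by cases (use Branch disj in \<open>auto simp: n\<close>)
qed auto

lemma rights_after_split:
  assumes "steep T" "p \<in> pts T" "q \<in> pts T" "q $ 1 < p $ 1" "split_depth T p q < n"
  shows "rights T (split_depth T p q) p < rights T n p"
  using assms
proof (induction T arbitrary: n)
  case (Branch l r)
  have disj: "pts l \<inter> pts r = {}"
    using Branch.prems(1) by (rule steep_disjoint)
  have less: "\<And>x y. x \<in> pts l \<Longrightarrow> y \<in> pts r \<Longrightarrow> x $ 1 < y $ 1"
    using Branch.prems(1) by auto
  obtain n' where n: "n = Suc n'"
    using Branch.prems(5) by (cases n) auto
  have "\<not> (p \<in> pts l \<and> q \<in> pts r)"
    using less[of p q] Branch.prems(4) by (meson less_asym)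
  then consider "p \<in> pts l" "q \<in> pts l" | "p \<in> pts r" "q \<in> pts r" | "p \<in> pts r" "q \<in> pts l"
    using Branch.prems(2,3) unfolding btree.set by blast
  then show ?case
    by cases (use Branch disj in \<open>auto simp: n\<close>)
qed auto

lemma rights_mono: "m \<le> n \<Longrightarrow> rights T m p \<le> rights T n p"
proof (induction T arbitrary: m n)
  case (Branch l r)
  then show ?case by (cases m; cases n) auto
qed auto

text \<open>The first \<open>initial_lefts T q\<close> steps to \<open>q\<close> go left; a point
  leaving at one of them would lie to the right of \<open>q\<close>.\<close>

lemma initial_lefts_le_split_depth:
  assumes "steep T" "p \<in> pts T" "q \<in> pts T" "p $ 1 < q $ 1"
  shows "initial_lefts T q \<le> split_depth T p q"
  using assms
proof (induction T)
  case (Branch l r)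
  have less: "\<And>x y. x \<in> pts l \<Longrightarrow> y \<in> pts r \<Longrightarrow> x $ 1 < y $ 1"
    using Branch.prems(1) by auto
  have "\<not> (q \<in> pts l \<and> p \<in> pts r)"
    using less[of q p] Branch.prems(4) by (meson less_asym)
  then consider "p \<in> pts l" "q \<in> pts l" | "q \<in> pts r"
    using Branch.prems(2,3) unfolding btree.set by blast
  then show ?case
    by cases (use Branch steep_disjoint[of l r] in auto)
qed auto

lemma initial_lefts_le_lefts: "initial_lefts T p \<le> n \<Longrightarrow> initial_lefts T p \<le> lefts T n p"
proof (induction T arbitrary: n)
  case (Branch l r)
  then show ?case by (cases n) auto
qed auto

lemma rights_eq_0: "n \<le> initial_lefts T p \<Longrightarrow> rights T n p = 0"
proof (induction T arbitrary: n)
  case (Branch l r)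
  then show ?case by (cases n) (auto split: if_splits)
qed auto

text \<open>Splitting this late, \<open>q\<close> shares with \<open>p\<close> the first right turn
  and all left turns before it.\<close>

lemma initial_lefts_eq:
  "steep T \<Longrightarrow> initial_lefts T p < split_depth T p q \<Longrightarrow> initial_lefts T q = initial_lefts T p"
proof (induction T)
  case (Branch l r)
  then show ?case using steep_disjoint[of l r] by (auto split: if_splits)
qed auto

section \<open>Trees of extended Erdos-Szekeres sets\<close>

inductive ES_tree :: "nat \<Rightarrow> nat \<Rightarrow> 'a btree \<Rightarrow> bool" where
  tip: "i = 0 \<or> j = 0 \<Longrightarrow> ES_tree i j (Tip x)"
| branch: "ES_tree i (Suc j) l \<Longrightarrow> ES_tree (Suc i) j r \<Longrightarrow> ES_tree (Suc i) (Suc j) (Branch l r)"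

inductive XES_tree :: "nat \<Rightarrow> nat \<Rightarrow> 'a btree \<Rightarrow> bool" for k where
  tip: "XES_tree k 0 (Tip x)"
| branch: "m < k \<Longrightarrow> XES_tree k m l \<Longrightarrow> ES_tree (Suc m) (k - Suc m) r \<Longrightarrow> XES_tree k (Suc m) (Branch l r)"

lemma lefts_ES_tree: "ES_tree i j T \<Longrightarrow> lefts T n p \<le> i"
proof (induction arbitrary: n rule: ES_tree.induct)
  case (branch i j l r)
  then show ?case by (cases n) auto
qed auto

lemma rights_ES_tree: "ES_tree i j T \<Longrightarrow> rights T n p \<le> j"
proof (induction arbitrary: n rule: ES_tree.induct)
  case (branch i j l r)
  then show ?case by (cases n) auto
qed auto

text \<open>After \<open>n\<close> steps the path still stands at a branching, because
  \<open>q\<close> has yet to split off. Its second index is positive, so not all \<open>j\<close>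
  right turns are used up.\<close>

lemma rights_ES_tree_less:
  "ES_tree i j T \<Longrightarrow> steep T \<Longrightarrow> p \<in> pts T \<Longrightarrow> q \<in> pts T \<Longrightarrow> p \<noteq> q \<Longrightarrow>
    n \<le> split_depth T p q \<Longrightarrow> rights T n p < j"
proof (induction arbitrary: n rule: ES_tree.induct)
  case (branch i j l r)
  then show ?case using steep_disjoint[of l r] by (cases n) (auto split: if_splits)
qed auto

lemma lefts_XES_tree: "XES_tree k m T \<Longrightarrow> lefts T n p \<le> m"
proof (induction arbitrary: n rule: XES_tree.induct)
  case (branch m l r)
  then show ?case using lefts_ES_tree[OF branch(3)] by (cases n) auto
qed auto

text \<open>One right turn enters a block \<open>ES(i, j)\<close> with
  \<open>j = k - m + initial_lefts T p\<close>, and at most \<open>j\<close> more follow inside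
  it.\<close>

lemma rights_XES_tree: "XES_tree k m T \<Longrightarrow> rights T n p \<le> k - m + initial_lefts T p + 1"
proof (induction arbitrary: n rule: XES_tree.induct)
  case (branch m l r)
  show ?case
  proof (cases n)
    case (Suc n')
    then show ?thesis
      using branch.IH[of n'] branch.hyps(1) rights_ES_tree[OF branch.hyps(3), of n' p] by auto
  qed auto
qed auto

text \<open>Saves one over the general bound: past the initial left turns the path is inside a block
  and at a branching of it, where a right turn is still in reserve.\<close>

lemma rights_XES_tree_before_split:
  "XES_tree k m T \<Longrightarrow> steep T \<Longrightarrow> p \<in> pts T \<Longrightarrow> q \<in> pts T \<Longrightarrow> p \<noteq> q \<Longrightarrow> initial_lefts T p < n \<Longrightarrow>
    n \<le> split_depth T p q \<Longrightarrow> rights T n p \<le> k - m + initial_lefts T p"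
proof (induction arbitrary: n rule: XES_tree.induct)
  case (branch m l r)
  have disj: "pts l \<inter> pts r = {}"
    using branch.prems(1) by (rule steep_disjoint)
  obtain n' where n: "n = Suc n'"
    using branch.prems(5) by (cases n) auto
  show ?case
  proof (cases "p \<in> pts l")
    case True
    then have "p \<notin> pts r" using disj by auto
    then show ?thesis
      using True branch.prems branch.IH[of n'] branch.hyps(1) by (auto simp: n split: if_splits)
  next
    case False
    then have "p \<in> pts r" "q \<in> pts r" "n' \<le> split_depth r p q"
      using branch.prems by (auto simp: n split: if_splits)
    then have "rights r n' p < k - Suc m"
      using rights_ES_tree_less[OF branch.hyps(3)] branch.prems by auto
    then show ?thesis using False by (simp add: n)
  qed
qed auto

text \<open>One point is taken from each block. Two of them part where the block of the right-hand
  one leaves the leftmost path.\<close>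

lemma XES_tree_transversal:
  "XES_tree k m T \<Longrightarrow> steep T \<Longrightarrow> \<exists>Q\<subseteq>pts T. card Q = Suc m \<and>
     (\<forall>p\<in>Q. \<forall>q\<in>Q. p $ 1 < q $ 1 \<longrightarrow>
        split_depth T p q = initial_lefts T q \<and> initial_lefts T q < initial_lefts T p)"
proof (induction rule: XES_tree.induct)
  case (tip x)
  show ?case by (rule exI[of _ "{x}"]) auto
next
  case (branch m l r)
  have disj: "pts l \<inter> pts r = {}"
    using branch.prems by (rule steep_disjoint)
  obtain Q where Q: "Q \<subseteq> pts l" "card Q = Suc m" "\<forall>p\<in>Q. \<forall>q\<in>Q. p $ 1 < q $ 1 \<longrightarrow>
        split_depth l p q = initial_lefts l q \<and> initial_lefts l q < initial_lefts l p"
    using branch by auto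
  obtain y where y: "y \<in> pts r"
    using pts_nonempty[of r] by auto
  have "finite Q" "y \<notin> Q" "y \<notin> pts l"
    using Q y disj finite_subset[OF Q(1)] by auto
  have less: "\<And>x. x \<in> Q \<Longrightarrow> x $ 1 < y $ 1 \<and> x \<notin> pts r \<and> x \<in> pts l"
    using branch.prems Q y disj by auto
  show ?case
    by (rule exI[of _ "insert y Q"])
      (use Q y \<open>finite Q\<close> \<open>y \<notin> Q\<close> \<open>y \<notin> pts l\<close> less in \<open>auto dest: less_asym less\<close>)
qed

subsection \<open>Compositions as branchings\<close>

lemma steep_translate:
  fixes v :: "real^2"
  shows "steep T \<Longrightarrow> steep (map_btree (\<lambda>p. p + v) T)"
  by (induction T) (auto simp: btree.set_map slope_def)

lemma ES_tree_map: "ES_tree i j T \<Longrightarrow> ES_tree i j (map_btree f T)"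
  by (induction rule: ES_tree.induct) (auto intro: ES_tree.intros)

text \<open>A composition moves its second set by some vector, so the right subtree is translated
  before joining; this changes neither slopes nor order.\<close>

lemma steep_composition:
  assumes "composition (pts l) (pts r) Z" "steep l" "steep r"
  obtains v where "steep (Branch l (map_btree (\<lambda>p. p + v) r))" "pts (Branch l (map_btree (\<lambda>p. p + v) r)) = Z"
proof -
  obtain v where v: "Z = pts l \<union> (\<lambda>p. p + v) ` pts r"
    "\<forall>p\<in>pts l. \<forall>q\<in>(\<lambda>p. p + v) ` pts r. p $ 1 < q $ 1"
    "\<forall>p\<in>pts l. \<forall>q\<in>(\<lambda>p. p + v) ` pts r.
           (\<forall>a\<in>pts l. \<forall>b\<in>pts l. a \<noteq> b \<longrightarrow> slope a b < slope p q) \<and>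
           (\<forall>a\<in>(\<lambda>p. p + v) ` pts r. \<forall>b\<in>(\<lambda>p. p + v) ` pts r. a \<noteq> b \<longrightarrow> slope a b < slope p q)"
    using assms(1) unfolding composition_def by (elim conjE exE) simp
  have "steep (map_btree (\<lambda>p. p + v) r)" using assms(3) by (rule steep_translate)
  with v assms(2) show ?thesis
    by (intro that[of v]) (simp_all only: steep.simps btree.set btree.set_map, blast)
qed

lemma is_ES_tree: "is_ES i j X \<Longrightarrow> \<exists>T. ES_tree i j T \<and> steep T \<and> pts T = X"
proof (induction rule: is_ES.induct)
  case (left k p)
  show ?case by (rule exI[of _ "Tip p"]) (auto intro: ES_tree.intros)
next
  case (right k p)
  show ?case by (rule exI[of _ "Tip p"]) (auto intro: ES_tree.intros)
next
  case (comp i j L M X)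
  obtain l r where lr: "ES_tree (i - 1) j l" "steep l" "pts l = L" "ES_tree i (j - 1) r" "steep r" "pts r = M"
    using comp.IH by auto
  then obtain v where v: "steep (Branch l (map_btree (\<lambda>p. p + v) r))" "pts (Branch l (map_btree (\<lambda>p. p + v) r)) = X"
    using comp.hyps steep_composition by metis
  have "ES_tree i j (Branch l (map_btree (\<lambda>p. p + v) r))"
    using ES_tree.branch[of "i - 1" "j - 1" l "map_btree (\<lambda>p. p + v) r"] lr(1) ES_tree_map[OF lr(4), of "\<lambda>p. p + v"]
      comp.hyps(1,2) by simp
  with v show ?case by blast
qed

lemma is_XES_upto_tree: "is_XES_upto k m X \<Longrightarrow> \<exists>T. XES_tree k m T \<and> steep T \<and> pts T = X"
proof (induction rule: is_XES_upto.induct)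
  case (first X)
  then obtain p where "X = {p}"
    by (auto elim: is_ES.cases)
  then show ?case by (intro exI[of _ "Tip p"]) (auto intro: XES_tree.intros)
next
  case (extend m L M X)
  obtain l r where lr: "XES_tree k m l" "steep l" "pts l = L" "ES_tree (Suc m) (k - Suc m) r" "steep r" "pts r = M"
    using extend.IH is_ES_tree[OF extend.hyps(3)] by auto
  then obtain v where v: "steep (Branch l (map_btree (\<lambda>p. p + v) r))" "pts (Branch l (map_btree (\<lambda>p. p + v) r)) = X"
    using extend.hyps steep_composition by metis
  have "XES_tree k (Suc m) (Branch l (map_btree (\<lambda>p. p + v) r))"
    using XES_tree.branch lr ES_tree_map extend.hyps(1) by blast
  with v show ?case by blast
qed

section \<open>The convex geometry of a finite point set\<close>

lemma closed_sets_iff: "A \<in> closed_sets X \<longleftrightarrow> A \<subseteq> X \<and> convex hull A \<inter> X \<subseteq> A"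
  unfolding closed_sets_def geom_closure_def using hull_subset[of A convex] by auto

lemma closed_sets_convex_Int: "convex S \<Longrightarrow> X \<inter> S \<in> closed_sets X"
  unfolding closed_sets_iff using hull_minimal[of "X \<inter> S" S convex] by auto

lemma singleton_closed: "x \<in> X \<Longrightarrow> {x} \<in> closed_sets X"
  by (simp add: closed_sets_iff)

lemma ground_set_closed: "X \<in> closed_sets X"
  by (simp add: closed_sets_iff)

lemma finite_closed_sets: "finite X \<Longrightarrow> finite (closed_sets X)"
  by (rule finite_subset[of _ "Pow X"]) (auto simp: closed_sets_def)

lemma closed_setsD: "A \<in> closed_sets X \<Longrightarrow> A \<subseteq> X"
  by (simp add: closed_sets_def)

text \<open>Extreme points of the hull of \<open>B\<close> outside \<open>A\<close> can be peeled off \<open>B\<close> one at a time.\<close>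

lemma closed_sets_insert:
  assumes "finite X" "A \<in> closed_sets X" "B \<in> closed_sets X" "A \<subset> B"
  shows "\<exists>y\<in>B - A. insert y A \<in> closed_sets X"
  using assms(3,4)
proof (induction "card (B - A)" arbitrary: B rule: less_induct)
  case less
  have BX: "B \<subseteq> X" "convex hull B \<inter> X \<subseteq> B"
    using less.prems(1) by (auto simp: closed_sets_iff)
  have finB: "finite B"
    using BX(1) assms(1) finite_subset by auto
  have "\<exists>e. e extreme_point_of convex hull B \<and> e \<notin> A"
  proof (rule ccontr)
    assume "\<not> ?thesis"
    then have "convex hull {e. e extreme_point_of convex hull B} \<subseteq> convex hull A"
      by (intro hull_mono) auto
    moreover have "convex hull B = convex hull {e. e extreme_point_of convex hull B}"
      using finB by (intro Krein_Milman_Minkowski) (auto intro: finite_imp_compact_convex_hull)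
    ultimately have "B \<subseteq> convex hull A \<inter> X"
      using hull_subset[of B convex] BX by auto
    then show False
      using assms(2) less.prems(2) by (auto simp: closed_sets_iff)
  qed
  then obtain e where e: "e extreme_point_of convex hull B" "e \<notin> A"
    by auto
  have eB: "e \<in> B"
    using e(1) extreme_point_of_convex_hull by blast
  have "convex hull (B - {e}) \<subseteq> convex hull B - {e}"
    using e(1) hull_subset[of B convex] by (intro hull_minimal) (auto simp: extreme_point_of_stillconvex)
  then have closed: "B - {e} \<in> closed_sets X"
    using BX by (auto simp: closed_sets_iff)
  show ?case
  proof (cases "A = B - {e}")
    case True
    then have "insert e A = B" using eB by auto
    then show ?thesis using less.prems e(2) eB by auto
  next
    case False
    then have "A \<subset> B - {e}" using less.prems(2) e(2) by auto
    moreover have "card (B - {e} - A) < card (B - A)"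
      using finB eB e(2) by (intro psubset_card_mono) auto
    ultimately show ?thesis using less.hyps[OF _ closed] by auto
  qed
qed

section \<open>Copoints and their attachment points\<close>

lemma point_cover_iff:
  "point_cover X A B \<longleftrightarrow> (\<exists>y. y \<notin> A \<and> B = insert y A \<and> B \<in> closed_sets X)"
proof
  assume "point_cover X A B"
  then obtain y where "B - A = {y}" "A \<subset> B" "B \<in> closed_sets X"
    unfolding point_cover_def by (auto simp: card_1_singleton_iff)
  then show "\<exists>y. y \<notin> A \<and> B = insert y A \<and> B \<in> closed_sets X"
    by (intro exI[of _ y]) auto
next
  assume "\<exists>y. y \<notin> A \<and> B = insert y A \<and> B \<in> closed_sets X"
  then obtain y where y: "y \<notin> A" "B = insert y A" "B \<in> closed_sets X" by auto
  then have "B - A = {y}" by auto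
  with y show "point_cover X A B" unfolding point_cover_def by auto
qed

lemma copointI:
  assumes "A \<in> closed_sets X" "x \<notin> A" "insert x A \<in> closed_sets X"
    and "\<And>y. y \<notin> A \<Longrightarrow> insert y A \<in> closed_sets X \<Longrightarrow> y = x"
  shows "A \<in> copoints X" "attach_point X A = x"
proof -
  have cover: "point_cover X A B \<longleftrightarrow> B = insert x A" for B
    unfolding point_cover_iff using assms(2-4) by blast
  then show "A \<in> copoints X" using assms(1) by (auto simp: copoints_def)
  have "insert x A - A = {x}" using assms(2) by auto
  then show "attach_point X A = x" by (simp add: attach_point_def cover)
qed

lemma copointD:
  assumes "A \<in> copoints X"
  shows "A \<in> closed_sets X" "attach_point X A \<notin> A" "insert (attach_point X A) A \<in> closed_sets X"
    "\<And>y. y \<notin> A \<Longrightarrow> insert y A \<in> closed_sets X \<Longrightarrow> y = attach_point X A"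
proof -
  obtain B where A: "A \<in> closed_sets X" and B: "point_cover X A B" and uniq: "\<And>C. point_cover X A C \<Longrightarrow> C = B"
    using assms unfolding copoints_def by auto
  obtain x where x: "x \<notin> A" "B = insert x A" "B \<in> closed_sets X"
    using B by (auto simp: point_cover_iff)
  have eq: "y = x" if "y \<notin> A" "insert y A \<in> closed_sets X" for y
  proof -
    have "insert y A = insert x A"
      using uniq[of "insert y A"] that x(2) unfolding point_cover_iff by blast
    then show ?thesis using that(1) x(1) by auto
  qed
  have att: "attach_point X A = x"
    using x(2,3) by (intro copointI(2)[OF A x(1)] eq) simp_all
  show "A \<in> closed_sets X" "attach_point X A \<notin> A" "insert (attach_point X A) A \<in> closed_sets X"
    using A x att by simp_all
  show "\<And>y. y \<notin> A \<Longrightarrow> insert y A \<in> closed_sets X \<Longrightarrow> y = attach_point X A"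
    unfolding att by (rule eq)
qed

lemma attach_point_in: "A \<in> copoints X \<Longrightarrow> attach_point X A \<in> X"
  using copointD(3) closed_setsD by blast

text \<open>Inside \<open>B\<close> the set \<open>A\<close> extends by one point to a closed set,
  and a copoint has only one such point. Copoints are thus maximal among the closed sets missing
  their attachment point.\<close>

lemma attach_point_in_superset:
  assumes "finite X" "A \<in> copoints X" "B \<in> closed_sets X" "A \<subset> B"
  shows "attach_point X A \<in> B"
  using closed_sets_insert[OF assms(1) copointD(1)[OF assms(2)] assms(3,4)] copointD(4)[OF assms(2)] by blast

section \<open>Critical pairs of the lattice of closed sets\<close>

lemma critical_pairs_closed_order_iff:
  "(A, B) \<in> critical_pairs (closed_sets X) (closed_order X) \<longleftrightarrow>
    A \<in> closed_sets X \<and> B \<in> closed_sets X \<and> \<not> A \<subseteq> B \<and> \<not> B \<subseteq> A \<and>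
    (\<forall>U\<in>closed_sets X. B \<subset> U \<longrightarrow> A \<subset> U) \<and> (\<forall>D\<in>closed_sets X. D \<subset> A \<longrightarrow> D \<subset> B)"
  unfolding critical_pairs_def closed_order_def mem_Collect_eq case_prod_conv psubset_eq by blast

text \<open>The first component is a singleton, since otherwise all its singletons, and hence
  itself, would lie below the second. The second is a copoint, since every larger closed set
  contains that point. On a one-point set the empty set is a copoint but comparable with the
  singleton, hence the bound on \<open>card X\<close>.\<close>

lemma critical_pairs_closed_sets:
  assumes "finite X" "card X \<ge> 2"
  shows "critical_pairs (closed_sets X) (closed_order X) =
    (\<lambda>A. ({attach_point X A}, A)) ` copoints X"
proof (intro equalityI subsetI)
  fix P assume P_in: "P \<in> critical_pairs (closed_sets X) (closed_order X)"
  obtain A B where P: "P = (A, B)" by force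
  have AB: "A \<in> closed_sets X" "B \<in> closed_sets X" "\<not> A \<subseteq> B" "\<not> B \<subseteq> A"
    and up: "\<And>U. U \<in> closed_sets X \<Longrightarrow> B \<subset> U \<Longrightarrow> A \<subseteq> U"
    and down: "\<And>D. D \<in> closed_sets X \<Longrightarrow> D \<subset> A \<Longrightarrow> D \<subseteq> B"
    using P_in unfolding P critical_pairs_closed_order_iff by blast+
  have "\<exists>x\<in>A. {x} = A"
  proof (rule ccontr)
    assume no: "\<not> ?thesis"
    have "x \<in> B" if "x \<in> A" for x
    proof -
      have "{x} \<in> closed_sets X" using that closed_setsD[OF AB(1)] by (auto intro: singleton_closed)
      moreover have "{x} \<subset> A" using no that by auto
      ultimately show ?thesis using down by auto
    qed
    then show False using AB(3) by auto
  qed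
  then obtain x where A: "A = {x}" by auto
  have xB: "x \<notin> B" using AB(3) A by auto
  have eq: "y = x" if "y \<notin> B" "insert y B \<in> closed_sets X" for y
    using up[OF that(2)] that(1) A xB by auto
  have "x \<in> X" using closed_setsD[OF AB(1)] A by auto
  then have "B \<subset> X" using xB closed_setsD[OF AB(2)] by auto
  then obtain y where "y \<in> X - B" "insert y B \<in> closed_sets X"
    using closed_sets_insert[OF assms(1) AB(2) ground_set_closed] by auto
  then have "insert x B \<in> closed_sets X" using eq[of y] by simp
  then have "B \<in> copoints X" "attach_point X B = x"
    using copointI[OF AB(2) xB _ eq] by auto
  then show "P \<in> (\<lambda>A. ({attach_point X A}, A)) ` copoints X"
    using P A by auto
next
  fix P assume "P \<in> (\<lambda>A. ({attach_point X A}, A)) ` copoints X"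
  then obtain B where B: "B \<in> copoints X" and P: "P = ({attach_point X B}, B)" by auto
  have "B \<noteq> {}"
  proof
    assume "B = {}"
    then have "y = attach_point X B" if "y \<in> X" for y
      using copointD(4)[OF B, of y] singleton_closed[OF that] by simp
    then have "X \<subseteq> {attach_point X B}" by blast
    then have "card X \<le> 1" using card_mono[of "{attach_point X B}" X] by auto
    then show False using assms(2) by auto
  qed
  then have "\<not> B \<subseteq> {attach_point X B}" using copointD(2)[OF B] by auto
  moreover have "\<And>U. U \<in> closed_sets X \<Longrightarrow> B \<subset> U \<Longrightarrow> attach_point X B \<in> U"
    using attach_point_in_superset[OF assms(1) B] .
  moreover have "{attach_point X B} \<in> closed_sets X"
    using attach_point_in[OF B] by (rule singleton_closed)
  ultimately show "P \<in> critical_pairs (closed_sets X) (closed_order X)"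
    using copointD(1,2)[OF B] \<open>B \<noteq> {}\<close>
    unfolding P critical_pairs_closed_order_iff by blast
qed

section \<open>Half-planes at a point of a steep tree\<close>

text \<open>The points of the tree strictly above a line through \<open>p\<close> whose slope separates the depths
  below \<open>n\<close> from the others, and those strictly below it.\<close>

definition above_line :: "(real^2) btree \<Rightarrow> nat \<Rightarrow> real^2 \<Rightarrow> (real^2) set" where
  "above_line T n p = {q \<in> pts T - {p}. p $ 1 < q $ 1 \<longleftrightarrow> split_depth T p q < n}"

definition below_line :: "(real^2) btree \<Rightarrow> nat \<Rightarrow> real^2 \<Rightarrow> (real^2) set" where
  "below_line T n p = {q \<in> pts T - {p}. p $ 1 < q $ 1 \<longleftrightarrow> n \<le> split_depth T p q}"

lemma finite_sets_separated:
  fixes A B :: "real set"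
  assumes "finite A" "finite B" "\<And>a b. a \<in> A \<Longrightarrow> b \<in> B \<Longrightarrow> a < b"
  shows "\<exists>s. (\<forall>a\<in>A. a < s) \<and> (\<forall>b\<in>B. s < b)"
proof (cases "A = {} \<or> B = {}")
  case True
  \<comment> \<open>Inserting 0 keeps \<open>Max\<close> defined when \<open>A\<close> is
    empty.\<close>
  have "a < Max (insert 0 A) + 1" if "a \<in> A" for a
    by (rule le_less_trans[OF Max_ge less_add_one]) (use assms(1) that in auto)
  moreover have "Min (insert 0 B) - 1 < b" if "b \<in> B" for b
  proof -
    have "Min (insert 0 B) \<le> b" using assms(2) that by (intro Min_le) auto
    then show ?thesis by linarith
  qed
  ultimately show ?thesis using True by blast
next
  case False
  then have "Max A < Min B" using assms by simp
  then obtain s where "Max A < s" "s < Min B" using dense by blast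
  then show ?thesis using assms(1,2) False by auto
qed

lemma inner_real2: "(a::real^2) \<bullet> x = a $ 1 * x $ 1 + a $ 2 * x $ 2"
  by (simp add: inner_vec_def sum_2)

lemma slope_less_iff:
  "p $ 1 < q $ 1 \<Longrightarrow> s < slope p q \<longleftrightarrow> s * (q $ 1 - p $ 1) < q $ 2 - p $ 2"
  "q $ 1 < p $ 1 \<Longrightarrow> s < slope p q \<longleftrightarrow> q $ 2 - p $ 2 < s * (q $ 1 - p $ 1)"
  "p $ 1 < q $ 1 \<Longrightarrow> slope p q < s \<longleftrightarrow> q $ 2 - p $ 2 < s * (q $ 1 - p $ 1)"
  "q $ 1 < p $ 1 \<Longrightarrow> slope p q < s \<longleftrightarrow> s * (q $ 1 - p $ 1) < q $ 2 - p $ 2"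
  by (simp_all add: slope_def field_simps)

text \<open>Slopes from \<open>p\<close> decrease with depth, so some \<open>s\<close> separates
  depths at least \<open>n\<close> from smaller ones. Above the line means slope above
  \<open>s\<close> to the right of \<open>p\<close>, but slope below \<open>s\<close> to the left;
  hence the equivalences in the two definitions.\<close>

lemma above_below_halfplanes:
  assumes "steep T" "p \<in> pts T"
  obtains s where "above_line T n p = pts T \<inter> {q. s * (q $ 1 - p $ 1) < q $ 2 - p $ 2}"
    "below_line T n p = pts T \<inter> {q. q $ 2 - p $ 2 < s * (q $ 1 - p $ 1)}"
proof -
  let ?A = "slope p ` {q \<in> pts T - {p}. n \<le> split_depth T p q}"
  let ?B = "slope p ` {q \<in> pts T - {p}. split_depth T p q < n}"
  have "\<exists>s. (\<forall>a\<in>?A. a < s) \<and> (\<forall>b\<in>?B. s < b)"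
    by (rule finite_sets_separated) (use slope_less_if_split_depth_less[OF assms] in auto)
  then obtain s where s: "\<And>q. q \<in> pts T - {p} \<Longrightarrow> n \<le> split_depth T p q \<Longrightarrow> slope p q < s"
    "\<And>q. q \<in> pts T - {p} \<Longrightarrow> split_depth T p q < n \<Longrightarrow> s < slope p q"
    by auto
  have *: "(q \<in> above_line T n p \<longleftrightarrow> s * (q $ 1 - p $ 1) < q $ 2 - p $ 2) \<and>
      (q \<in> below_line T n p \<longleftrightarrow> q $ 2 - p $ 2 < s * (q $ 1 - p $ 1))" if q: "q \<in> pts T - {p}" for q
  proof -
    have "q $ 1 < p $ 1 \<or> p $ 1 < q $ 1"
      using steep_fst_neq[OF assms, of q] q by (auto simp: neq_iff)
    then show ?thesis
      using s[OF q] slope_less_iff[of p q s] slope_less_iff[of q p s] q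
      by (cases "split_depth T p q < n") (auto simp: above_line_def below_line_def)
  qed
  have "(q \<in> above_line T n p \<longleftrightarrow> q \<in> pts T \<and> s * (q $ 1 - p $ 1) < q $ 2 - p $ 2) \<and>
      (q \<in> below_line T n p \<longleftrightarrow> q \<in> pts T \<and> q $ 2 - p $ 2 < s * (q $ 1 - p $ 1))" for q
  proof (cases "q \<in> pts T - {p}")
    case False
    then show ?thesis by (auto simp: above_line_def below_line_def)
  qed (use * in blast)
  then show thesis by (intro that[of s]) blast+
qed

lemma above_closed: "steep T \<Longrightarrow> p \<in> pts T \<Longrightarrow> above_line T n p \<in> closed_sets (pts T)"
proof -
  assume "steep T" "p \<in> pts T"
  then obtain s where s: "above_line T n p = pts T \<inter> {q. s * (q $ 1 - p $ 1) < q $ 2 - p $ 2}"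
    by (rule above_below_halfplanes)
  have "{q::real^2. s * (q $ 1 - p $ 1) < q $ 2 - p $ 2} = {q. vector [s, -1] \<bullet> q < s * p $ 1 - p $ 2}"
    by (auto simp: inner_real2 algebra_simps)
  then show ?thesis
    unfolding s by (intro closed_sets_convex_Int) (simp add: convex_halfspace_lt)
qed

lemma below_closed: "steep T \<Longrightarrow> p \<in> pts T \<Longrightarrow> below_line T n p \<in> closed_sets (pts T)"
proof -
  assume "steep T" "p \<in> pts T"
  then obtain s where s: "below_line T n p = pts T \<inter> {q. q $ 2 - p $ 2 < s * (q $ 1 - p $ 1)}"
    by (rule above_below_halfplanes)
  have "{q::real^2. q $ 2 - p $ 2 < s * (q $ 1 - p $ 1)} = {q. vector [s, -1] \<bullet> q > s * p $ 1 - p $ 2}"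
    by (auto simp: inner_real2 algebra_simps)
  then show ?thesis
    unfolding s by (intro closed_sets_convex_Int) (simp add: convex_halfspace_gt)
qed

lemma cut_nat_sets:
  fixes A B :: "nat set"
  assumes "\<And>a. a \<in> A \<Longrightarrow> a < N" "\<And>a b. a \<in> A \<Longrightarrow> b \<in> B \<Longrightarrow> a < b"
  shows "\<exists>n. (\<forall>a\<in>A. a < n) \<and> (\<forall>b\<in>B. n \<le> b)"
proof (cases "B = {}")
  case False
  then have "(LEAST b. b \<in> B) \<in> B" using LeastI_ex[of "\<lambda>b. b \<in> B"] by auto
  then show ?thesis using assms(2) Least_le[of "\<lambda>b. b \<in> B"] by blast
\<comment> \<open>With \<open>B\<close> empty the cut is placed at \<open>N\<close>.\<close>
qed (use assms(1) in auto)

text \<open>Some line through \<open>p\<close> has \<open>C\<close> strictly on one side. Its slope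
  separates the slopes to points of \<open>C\<close> right of \<open>p\<close> from those to the
  left, hence also their depths, and a cut between the depths gives \<open>n\<close>.\<close>

lemma closed_subset_above_or_below:
  assumes T: "steep T" "p \<in> pts T" and C: "C \<in> closed_sets (pts T)" "p \<notin> C"
  shows "\<exists>n. C \<subseteq> above_line T n p \<or> C \<subseteq> below_line T n p"
proof -
  have Csub: "C \<subseteq> pts T - {p}" and "p \<notin> convex hull C"
    using C T(2) by (auto simp: closed_sets_iff)
  have "finite C" using finite_subset[OF Csub] by simp
  then have "closed (convex hull C)"
    by (intro compact_imp_closed finite_imp_compact_convex_hull)
  then obtain a b where ab: "a \<bullet> p < b" "\<forall>x\<in>convex hull C. a \<bullet> x > b"
    using separating_hyperplane_closed_point[OF convex_convex_hull] \<open>p \<notin> convex hull C\<close> by blast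
  have pos: "a $ 1 * (q $ 1 - p $ 1) + a $ 2 * (q $ 2 - p $ 2) > 0" if "q \<in> C" for q
  proof -
    have "a \<bullet> p < a \<bullet> q" using ab that hull_subset[of C convex] by fastforce
    then show ?thesis by (simp add: inner_real2 algebra_simps)
  qed
  have side: "q $ 1 < p $ 1 \<or> p $ 1 < q $ 1" if "q \<in> C" for q
    using steep_fst_neq[OF T, of q] that Csub by (auto simp: neq_iff)
  let ?R = "{q \<in> C. p $ 1 < q $ 1}" and ?L = "{q \<in> C. q $ 1 < p $ 1}"
  have bound: "\<And>q. split_depth T p q < size T + 1" by (rule split_depth_less_size)
  have neq: "split_depth T p q \<noteq> split_depth T p q'" if "q \<in> ?R" "q' \<in> ?L" for q q'
    using same_side_if_split_depth_eq[OF T, of q q'] that Csub by auto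
  have "(\<forall>q\<in>?R. \<forall>q'\<in>?L. split_depth T p q < split_depth T p q') \<or>
        (\<forall>q\<in>?R. \<forall>q'\<in>?L. split_depth T p q' < split_depth T p q)"
  proof (cases "a $ 2" "0::real" rule: linorder_cases)
    \<comment> \<open>The line is vertical, so \<open>C\<close> lies entirely to one side of
      \<open>p\<close>.\<close>
    case equal
    then have "\<forall>q\<in>C. 0 < a $ 1 \<and> p $ 1 < q $ 1 \<or> a $ 1 < 0 \<and> q $ 1 < p $ 1"
      using pos by (auto simp: zero_less_mult_iff)
    then have "?R = {} \<or> ?L = {}"
      by (cases "0 < a $ 1") force+
    then show ?thesis by auto
  next
    case greater
    let ?s = "- (a $ 1) / a $ 2"
    have h: "?s * (q $ 1 - p $ 1) < q $ 2 - p $ 2" if "q \<in> C" for q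
      using pos[OF that] greater by (simp add: field_simps)
    have "split_depth T p q < split_depth T p q'" if q: "q \<in> ?R" "q' \<in> ?L" for q q'
    proof -
      have "slope p q' < ?s" "?s < slope p q"
        using h slope_less_iff(1)[of p q ?s] slope_less_iff(4)[of q' p ?s] q by auto
      then have "\<not> split_depth T p q' < split_depth T p q"
        using slope_less_if_split_depth_less[OF T, of q' q] q Csub by force
      then show ?thesis using neq[OF q] by auto
    qed
    then show ?thesis by blast
  next
    case less
    let ?s = "- (a $ 1) / a $ 2"
    have h: "q $ 2 - p $ 2 < ?s * (q $ 1 - p $ 1)" if "q \<in> C" for q
      using pos[OF that] less by (simp add: field_simps)
    have "split_depth T p q' < split_depth T p q" if q: "q \<in> ?R" "q' \<in> ?L" for q q'
    proof -
      have "slope p q < ?s" "?s < slope p q'"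
        using h slope_less_iff(3)[of p q ?s] slope_less_iff(2)[of q' p ?s] q by auto
      then have "\<not> split_depth T p q < split_depth T p q'"
        using slope_less_if_split_depth_less[OF T, of q q'] q Csub by force
      then show ?thesis using neq[OF q] by auto
    qed
    then show ?thesis by blast
  qed
  then show ?thesis
  proof
    assume "\<forall>q\<in>?R. \<forall>q'\<in>?L. split_depth T p q < split_depth T p q'"
    then obtain n where "\<forall>a\<in>split_depth T p ` ?R. a < n" "\<forall>b\<in>split_depth T p ` ?L. n \<le> b"
      using cut_nat_sets[of "split_depth T p ` ?R" "size T + 1" "split_depth T p ` ?L"] bound by auto
    then have "C \<subseteq> above_line T n p"
      using side Csub by (fastforce simp: above_line_def)
    then show ?thesis by blast
  next
    assume "\<forall>q\<in>?R. \<forall>q'\<in>?L. split_depth T p q' < split_depth T p q"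
    then obtain n where "\<forall>a\<in>split_depth T p ` ?L. a < n" "\<forall>b\<in>split_depth T p ` ?R. n \<le> b"
      using cut_nat_sets[of "split_depth T p ` ?L" "size T + 1" "split_depth T p ` ?R"] bound by auto
    then have "C \<subseteq> below_line T n p"
      using side Csub by (fastforce simp: below_line_def)
    then show ?thesis by blast
  qed
qed

section \<open>Ranking points along copoints\<close>

text \<open>A set attached to \<open>p\<close> is split invariant if it contains each subtree hanging off the path
  to \<open>p\<close> either completely or not at all.\<close>

definition split_invariant :: "'a btree \<Rightarrow> 'a \<Rightarrow> 'a set \<Rightarrow> bool" where
  "split_invariant T p A \<longleftrightarrow> (\<forall>q\<in>pts T - {p}. \<forall>q'\<in>pts T - {p}.
     split_depth T p q = split_depth T p q' \<longrightarrow> q \<in> A \<longrightarrow> q' \<in> A)"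

lemma split_invariantD:
  "split_invariant T p A \<Longrightarrow> q \<in> pts T \<Longrightarrow> q' \<in> pts T \<Longrightarrow> q \<noteq> p \<Longrightarrow> q' \<noteq> p \<Longrightarrow>
    split_depth T p q = split_depth T p q' \<Longrightarrow> q \<in> A \<Longrightarrow> q' \<in> A"
  unfolding split_invariant_def by blast

lemma split_invariant_above: "steep T \<Longrightarrow> p \<in> pts T \<Longrightarrow> split_invariant T p (above_line T n p)"
  unfolding split_invariant_def above_line_def using same_side_if_split_depth_eq[of T p] by auto

lemma split_invariant_below: "steep T \<Longrightarrow> p \<in> pts T \<Longrightarrow> split_invariant T p (below_line T n p)"
  unfolding split_invariant_def below_line_def using same_side_if_split_depth_eq[of T p] by auto

text \<open>If no two members are mutually adjacent, then at every branching the sets can cross in one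
  direction only: a set that meets the other side contains all of it.\<close>

lemma rank_exists:
  fixes T :: "(real^2) btree"
  assumes "steep T"
    and "\<And>p A. (p, A) \<in> F \<Longrightarrow> p \<in> pts T \<Longrightarrow> split_invariant T p A"
    and nonadj: "\<And>p A q B. (p, A) \<in> F \<Longrightarrow> (q, B) \<in> F \<Longrightarrow> p \<in> B \<Longrightarrow> q \<in> A \<Longrightarrow> False"
  shows "\<exists>\<rho>::real^2 \<Rightarrow> nat. \<forall>(p, A)\<in>F. p \<in> pts T \<longrightarrow> (\<forall>q\<in>A \<inter> pts T. \<rho> q < \<rho> p)"
  using assms(1,2)
proof (induction T)
  case (Tip x)
  \<comment> \<open>Non-adjacency is applied to a member and itself.\<close>
  have "x \<notin> A" if "(x, A) \<in> F" for A
    using nonadj[OF that that] by auto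
  then show ?case by auto
next
  case (Branch l r)
  have disj: "pts l \<inter> pts r = {}"
    using Branch.prems(1) by (rule steep_disjoint)
  have inv: "split_invariant (Branch l r) p A" if "(p, A) \<in> F" "p \<in> pts l \<union> pts r" for p A
    using Branch.prems(2) that by auto
  have inv_l: "split_invariant l p A" if "(p, A) \<in> F" "p \<in> pts l" for p A
    unfolding split_invariant_def
  proof (intro ballI impI)
    fix q q' assume "q \<in> pts l - {p}" "q' \<in> pts l - {p}" "split_depth l p q = split_depth l p q'" "q \<in> A"
    then show "q' \<in> A"
      using split_invariantD[OF inv[OF that(1)], of q q'] that(2) by simp
  qed
  have "\<exists>\<rho>::real^2 \<Rightarrow> nat. \<forall>(p, A)\<in>F. p \<in> pts l \<longrightarrow> (\<forall>q\<in>A \<inter> pts l. \<rho> q < \<rho> p)"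
    using Branch.IH(1)[OF _ inv_l] Branch.prems(1) by simp
  then obtain \<rho>l :: "real^2 \<Rightarrow> nat" where
    \<rho>l: "\<And>p A q. (p, A) \<in> F \<Longrightarrow> p \<in> pts l \<Longrightarrow> q \<in> A \<Longrightarrow> q \<in> pts l \<Longrightarrow> \<rho>l q < \<rho>l p"
    by blast
  have inv_r: "split_invariant r p A" if "(p, A) \<in> F" "p \<in> pts r" for p A
    unfolding split_invariant_def
  proof (intro ballI impI)
    fix q q' assume "q \<in> pts r - {p}" "q' \<in> pts r - {p}" "split_depth r p q = split_depth r p q'" "q \<in> A"
    moreover have "p \<notin> pts l" using that disj by auto
    ultimately show "q' \<in> A"
      using split_invariantD[OF inv[OF that(1)], of q q'] that(2) by simp
  qed
  have "\<exists>\<rho>::real^2 \<Rightarrow> nat. \<forall>(p, A)\<in>F. p \<in> pts r \<longrightarrow> (\<forall>q\<in>A \<inter> pts r. \<rho> q < \<rho> p)"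
    using Branch.IH(2)[OF _ inv_r] Branch.prems(1) by simp
  then obtain \<rho>r :: "real^2 \<Rightarrow> nat" where
    \<rho>r: "\<And>p A q. (p, A) \<in> F \<Longrightarrow> p \<in> pts r \<Longrightarrow> q \<in> A \<Longrightarrow> q \<in> pts r \<Longrightarrow> \<rho>r q < \<rho>r p"
    by blast
  \<comment> \<open>All points of \<open>r\<close> leave the path to \<open>p\<close> at depth 0, so
    invariance gives all or none of them.\<close>
  have cross_l: "pts r \<subseteq> A" if "(p, A) \<in> F" "p \<in> pts l" "q \<in> A" "q \<in> pts r" for p A q
  proof
    fix q' assume q': "q' \<in> pts r"
    have "q \<notin> pts l" "q' \<notin> pts l" "p \<notin> pts r" using that q' disj by auto
    then show "q' \<in> A"
      using split_invariantD[OF inv[OF that(1)], of q q'] that(2-4) q' by auto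
  qed
  have cross_r: "pts l \<subseteq> A" if "(p, A) \<in> F" "p \<in> pts r" "q \<in> A" "q \<in> pts l" for p A q
  proof
    fix q' assume q': "q' \<in> pts l"
    have "q \<notin> pts r" "q' \<notin> pts r" "p \<notin> pts l" using that q' disj by auto
    then show "q' \<in> A"
      using split_invariantD[OF inv[OF that(1)], of q q'] that(2-4) q' by auto
  qed
  have bound: "f x < Suc (sum f (pts t))" if "x \<in> pts t" for f :: "real^2 \<Rightarrow> nat" and t x
    using member_le_sum[of x "pts t" f] that by auto
  \<comment> \<open>Members crossing from both sides would each contain the whole other side, and so
    be mutually adjacent.\<close>
  consider "\<And>p A q. (p, A) \<in> F \<Longrightarrow> p \<in> pts l \<Longrightarrow> q \<in> A \<Longrightarrow> q \<notin> pts r"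
    | "\<And>p A q. (p, A) \<in> F \<Longrightarrow> p \<in> pts r \<Longrightarrow> q \<in> A \<Longrightarrow> q \<notin> pts l"
  proof (cases "\<exists>p A q. (p, A) \<in> F \<and> p \<in> pts l \<and> q \<in> A \<and> q \<in> pts r")
    case True
    then obtain p A where A: "(p, A) \<in> F" "p \<in> pts l" "pts r \<subseteq> A"
      using cross_l by blast
    have "q \<notin> pts l" if B: "(p', B) \<in> F" "p' \<in> pts r" "q \<in> B" for p' B q
      using nonadj[OF A(1) B(1)] cross_r[OF B] A(2,3) B(2) by auto
    then show thesis using that(2) by auto
  qed (use that(1) in blast)
  then show ?case
  proof cases
    case 1
    \<comment> \<open>No set attached in \<open>l\<close> meets \<open>r\<close>, so
      \<open>r\<close> may be ranked above \<open>l\<close>; the offset exceeds every rank used on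
      \<open>l\<close>.\<close>
    define \<rho> where "\<rho> x = (if x \<in> pts l then \<rho>l x else Suc (sum \<rho>l (pts l)) + \<rho>r x)" for x
    have "\<rho> q < \<rho> p" if "(p, A) \<in> F" "p \<in> pts l \<union> pts r" "q \<in> A" "q \<in> pts l \<union> pts r" for p A q
    proof (cases "p \<in> pts l")
      case True
      then show ?thesis using 1[OF that(1) True that(3)] that \<rho>l[OF that(1) True] by (auto simp: \<rho>_def)
    next
      case False
      then show ?thesis
        using that \<rho>r[OF that(1), of q] bound[of q l \<rho>l] disj by (auto simp: \<rho>_def trans_less_add1)
    qed
    then show ?thesis by (intro exI[of _ \<rho>]) auto
  next
    case 2
    define \<rho> where "\<rho> x = (if x \<in> pts r then \<rho>r x else Suc (sum \<rho>r (pts r)) + \<rho>l x)" for x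
    have "\<rho> q < \<rho> p" if "(p, A) \<in> F" "p \<in> pts l \<union> pts r" "q \<in> A" "q \<in> pts l \<union> pts r" for p A q
    proof (cases "p \<in> pts r")
      case True
      then show ?thesis using 2[OF that(1) True that(3)] that \<rho>r[OF that(1) True] by (auto simp: \<rho>_def)
    next
      case False
      then show ?thesis
        using that \<rho>l[OF that(1), of q] bound[of q r \<rho>r] disj by (auto simp: \<rho>_def trans_less_add1)
    qed
    then show ?thesis by (intro exI[of _ \<rho>]) auto
  qed
qed

section \<open>Order dimension\<close>

text \<open>Closed sets are compared by largest rank, which is monotone, then by cardinality, which
  respects inclusion when ranks tie, then by an arbitrary numbering.\<close>

lemma reversing_linear_extension:
  fixes \<rho> :: "real^2 \<Rightarrow> nat"
  assumes "finite X"
  obtains s where "linear_extension (closed_sets X) (closed_order X) s"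
    "\<And>p A. p \<in> X \<Longrightarrow> A \<in> closed_sets X \<Longrightarrow> (\<And>q. q \<in> A \<Longrightarrow> \<rho> q < \<rho> p) \<Longrightarrow> (A, {p}) \<in> s"
proof -
  obtain g :: "(real^2) set \<Rightarrow> nat" where g: "inj_on g (closed_sets X)"
    using finite_imp_inj_to_nat_seg[OF finite_closed_sets[OF assms]] by blast
  \<comment> \<open>The shift by one puts the empty set, of value 0, below every singleton.\<close>
  define f where "f C = Max (insert 0 ((\<lambda>p. Suc (\<rho> p)) ` C))" for C
  define s where "s = {(A, B). A \<in> closed_sets X \<and> B \<in> closed_sets X \<and>
    (f A < f B \<or> f A = f B \<and> (card A < card B \<or> card A = card B \<and> g A \<le> g B))}"
  have fin: "finite A" if "A \<in> closed_sets X" for A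
    using that assms closed_setsD finite_subset by blast
  have f_mono: "f A \<le> f B" if "A \<subseteq> B" "B \<in> closed_sets X" for A B
    unfolding f_def using that fin by (intro Max_mono) auto
  have "linear_order_on (closed_sets X) s"
    unfolding linear_order_on_def partial_order_on_def preorder_on_def
  proof (intro conjI)
    show "s \<subseteq> closed_sets X \<times> closed_sets X" by (auto simp: s_def)
    show "refl_on (closed_sets X) s" by (auto simp: s_def refl_on_def)
    show "trans s" by (rule transI) (auto simp: s_def)
    show "antisym s" by (rule antisymI) (use g in \<open>auto simp: s_def dest: inj_onD\<close>)
    show "total_on (closed_sets X) s" by (auto simp: s_def total_on_def)
  qed
  moreover have "closed_order X \<subseteq> s"
  proof
    fix P assume "P \<in> closed_order X"
    then obtain A B where P: "P = (A, B)" "A \<in> closed_sets X" "B \<in> closed_sets X" "A \<subseteq> B"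
      by (auto simp: closed_order_def)
    then have "f A \<le> f B" "A = B \<or> card A < card B"
      using f_mono psubset_card_mono[OF fin[OF P(3)], of A] by auto
    then show "P \<in> s" using P by (auto simp: s_def)
  qed
  moreover have "(A, {p}) \<in> s" if p: "p \<in> X" and A: "A \<in> closed_sets X" and less: "\<And>q. q \<in> A \<Longrightarrow> \<rho> q < \<rho> p" for p A
  proof -
    have "f A < f {p}"
      using fin[OF A] less by (simp add: f_def)
    then show ?thesis using singleton_closed[OF p] A by (auto simp: s_def)
  qed
  ultimately show thesis using that unfolding linear_extension_def by blast
qed

text \<open>One extension per family puts its sets below the singletons of their points. If
  \<open>A\<close> is not contained in \<open>B\<close>, a member covering \<open>B\<close> and
  attached to a point of \<open>A\<close> outside \<open>B\<close> prevents \<open>A\<close> from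
  preceding \<open>B\<close> in that extension.\<close>

lemma geom_dim_realizer:
  assumes "finite X" "t > 0"
    and rank: "\<And>c. c < t \<Longrightarrow> \<exists>\<rho>::real^2 \<Rightarrow> nat. \<forall>(p, A)\<in>F c. \<forall>q\<in>A. \<rho> q < \<rho> p"
    and closed: "\<And>c p A. c < t \<Longrightarrow> (p, A) \<in> F c \<Longrightarrow> A \<in> closed_sets X"
    and cover: "\<And>p C. p \<in> X \<Longrightarrow> C \<in> closed_sets X \<Longrightarrow> p \<notin> C \<Longrightarrow> \<exists>c<t. \<exists>A. (p, A) \<in> F c \<and> C \<subseteq> A"
  shows "\<exists>s. (\<forall>i<t. linear_extension (closed_sets X) (closed_order X) (s i)) \<and>
    closed_order X = (\<Inter>i<t. s i)"
proof -
  have "\<exists>s. linear_extension (closed_sets X) (closed_order X) s \<and>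
      (\<forall>(p, A)\<in>F c. p \<in> X \<longrightarrow> p \<notin> A \<and> (A, {p}) \<in> s)" if c: "c < t" for c
  proof -
    obtain \<rho> :: "real^2 \<Rightarrow> nat" where "\<forall>(p, A)\<in>F c. \<forall>q\<in>A. \<rho> q < \<rho> p"
      using rank[OF c] by blast
    then have \<rho>: "\<And>p A q. (p, A) \<in> F c \<Longrightarrow> q \<in> A \<Longrightarrow> \<rho> q < \<rho> p"
      by blast
    obtain s where s: "linear_extension (closed_sets X) (closed_order X) s"
      "\<And>p A. p \<in> X \<Longrightarrow> A \<in> closed_sets X \<Longrightarrow> (\<And>q. q \<in> A \<Longrightarrow> \<rho> q < \<rho> p) \<Longrightarrow> (A, {p}) \<in> s"
      using reversing_linear_extension[OF assms(1), of \<rho>] by blast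
    have "p \<notin> A \<and> (A, {p}) \<in> s" if "(p, A) \<in> F c" "p \<in> X" for p A
      using \<rho>[OF that(1)] s(2)[OF that(2) closed[OF c that(1)]] by blast
    then show ?thesis using s(1) by blast
  qed
  then obtain s where s: "\<And>c. c < t \<Longrightarrow> linear_extension (closed_sets X) (closed_order X) (s c)"
    "\<And>c p A. c < t \<Longrightarrow> (p, A) \<in> F c \<Longrightarrow> p \<in> X \<Longrightarrow> p \<notin> A \<and> (A, {p}) \<in> s c"
    by (metis (no_types, lifting) case_prodD)
  have "(A, B) \<in> closed_order X" if AB: "\<And>i. i < t \<Longrightarrow> (A, B) \<in> s i" for A B
  proof -
    have clo: "A \<in> closed_sets X" "B \<in> closed_sets X"
      using AB[OF assms(2)] s(1)[OF assms(2)]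
      unfolding linear_extension_def linear_order_on_def partial_order_on_def preorder_on_def by auto
    have "A \<subseteq> B"
    proof (rule ccontr)
      assume "\<not> A \<subseteq> B"
      then obtain x where x: "x \<in> A" "x \<notin> B" by auto
      have xX: "x \<in> X" using x(1) closed_setsD[OF clo(1)] by auto
      obtain c A' where c: "c < t" "(x, A') \<in> F c" "B \<subseteq> A'"
        using cover[OF xX clo(2) x(2)] by auto
      have A': "A' \<in> closed_sets X" "x \<notin> A'" "(A', {x}) \<in> s c"
        using c closed s(2) xX by auto
      have "({x}, A) \<in> s c" "(B, A') \<in> s c"
        using s(1)[OF c(1)] clo A' c(3) x(1) singleton_closed[OF xX]
        unfolding linear_extension_def closed_order_def by auto
      moreover have "trans (s c)" "antisym (s c)"
        using s(1)[OF c(1)]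
        unfolding linear_extension_def linear_order_on_def partial_order_on_def preorder_on_def by auto
      \<comment> \<open>In \<open>s c\<close> the chain \<open>{x}\<close>, \<open>A\<close>,
        \<open>B\<close>, \<open>A'\<close>, \<open>{x}\<close> closes up, so its terms
        coincide.\<close>
      ultimately have "A' = {x}"
        using AB[OF c(1)] A'(3) by (meson antisymD transD)
      then show False using A'(2) by auto
    qed
    then show ?thesis using clo by (auto simp: closed_order_def)
  qed
  then show ?thesis
    using s(1) by (intro exI[of _ s]) (auto simp: linear_extension_def)
qed

text \<open>As for the Boolean lattice: each pair \<open>({p}, A p)\<close> must be reversed by some
  extension, and no extension reverses two of them.\<close>

lemma card_le_realizer_size:
  assumes Q: "Q \<subseteq> X" "\<And>p. p \<in> Q \<Longrightarrow> \<exists>A\<in>closed_sets X. p \<notin> A \<and> Q - {p} \<subseteq> A"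
    and s: "\<And>i. i < t \<Longrightarrow> linear_extension (closed_sets X) (closed_order X) (s i)"
    "closed_order X = (\<Inter>i<t. s i)"
  shows "card Q \<le> t"
proof -
  obtain A where A: "\<And>p. p \<in> Q \<Longrightarrow> A p \<in> closed_sets X \<and> p \<notin> A p \<and> Q - {p} \<subseteq> A p"
    using Q(2) by metis
  have "\<exists>i<t. ({p}, A p) \<notin> s i" if "p \<in> Q" for p
  proof -
    have "({p}, A p) \<notin> closed_order X" using A[OF that] by (simp add: closed_order_def)
    then show ?thesis unfolding s(2) by blast
  qed
  then obtain i where i: "\<And>p. p \<in> Q \<Longrightarrow> i p < t \<and> ({p}, A p) \<notin> s (i p)"
    by metis
  have lin: "linear_order_on (closed_sets X) (s j)" "closed_order X \<subseteq> s j" if "j < t" for j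
    using s(1)[OF that] by (auto simp: linear_extension_def)
  have rev: "(A p, {p}) \<in> s (i p)" if "p \<in> Q" for p
  proof -
    have "A p \<noteq> {p}" using A[OF that] by blast
    moreover have "A p \<in> closed_sets X" "{p} \<in> closed_sets X"
      using A[OF that] Q(1) that singleton_closed by blast+
    moreover have "total_on (closed_sets X) (s (i p))"
      using lin(1)[of "i p"] i[OF that] unfolding linear_order_on_def by blast
    ultimately have "(A p, {p}) \<in> s (i p) \<or> ({p}, A p) \<in> s (i p)"
      unfolding total_on_def by simp
    then show ?thesis using i[OF that] by simp
  qed
  \<comment> \<open>An extension reversing both pairs would contain the ascending chain
    \<open>{p}\<close>, \<open>A q\<close>, \<open>{q}\<close>, \<open>A p\<close>.\<close>
  have "inj_on i Q"
  proof (rule inj_onI, rule ccontr)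
    fix p q assume pq: "p \<in> Q" "q \<in> Q" "i p = i q" "p \<noteq> q"
    let ?s = "s (i p)"
    have "({q}, A p) \<in> closed_order X" "({p}, A q) \<in> closed_order X"
      using pq(1,2,4) A[OF pq(1)] A[OF pq(2)] singleton_closed Q(1) unfolding closed_order_def by blast+
    then have "({q}, A p) \<in> ?s" "({p}, A q) \<in> ?s"
      using lin(2)[of "i p"] i[OF pq(1)] by blast+
    moreover have "(A q, {q}) \<in> ?s" using rev[OF pq(2)] pq(3) by simp
    moreover have "trans ?s"
      using lin(1)[of "i p"] i[OF pq(1)] unfolding linear_order_on_def partial_order_on_def preorder_on_def by auto
    ultimately have "({p}, A p) \<in> ?s" by (meson transD)
    then show False using i[OF pq(1)] by auto
  qed
  moreover have "i ` Q \<subseteq> {..<t}" using i by auto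
  ultimately show ?thesis using card_inj_on_le[of i Q "{..<t}"] by auto
qed

section \<open>Colouring the copoints of extended Erdos-Szekeres sets\<close>

text \<open>The condition on \<open>n\<close> makes the colour of an upper set at least
  \<open>initial_lefts T p\<close>; smaller \<open>n\<close> only give smaller sets. A lower set
  with no right turn to count gets no colour: it lies to the right of \<open>p\<close>, inside an
  upper set.\<close>

definition colour_class :: "(real^2) btree \<Rightarrow> nat \<Rightarrow> ((real^2) \<times> (real^2) set) set" where
  "colour_class T c =
    {(p, above_line T n p) | p n. p \<in> pts T \<and> initial_lefts T p \<le> n \<and> lefts T n p = c} \<union>
    {(p, below_line T n p) | p n. p \<in> pts T \<and> rights T n p = Suc c}"

lemma colour_class_cases:
  assumes "(p, A) \<in> colour_class T c"
  obtains (above) n where "A = above_line T n p" "p \<in> pts T" "lefts T n p = c" "initial_lefts T p \<le> n"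
    | (below) n where "A = below_line T n p" "p \<in> pts T" "rights T n p = Suc c"
  using assms unfolding colour_class_def by blast

section \<open>Adjacency and covering for the colour classes\<close>

lemma above_or_below_ordered:
  assumes "p $ 1 < q $ 1"
  shows "q \<in> above_line T n p \<Longrightarrow> split_depth T p q < n" "q \<in> below_line T n p \<Longrightarrow> n \<le> split_depth T p q"
    "p \<in> above_line T n q \<Longrightarrow> n \<le> split_depth T p q" "p \<in> below_line T n q \<Longrightarrow> split_depth T p q < n"
  using assms by (auto simp: above_line_def below_line_def split_depth_commute[of T q p])

text \<open>Adjacency fixes how \<open>n\<close> and \<open>n'\<close> compare with the splitting
  depth, up to which both paths agree. Sets of one kind then differ in their counts; sets of
  different kinds are compared through \<open>initial_lefts T q\<close>.\<close>

lemma colour_class_nonadjacent_ordered: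
  assumes T: "steep T" "XES_tree k k T"
    and F: "(p, A) \<in> colour_class T c" "(q, B) \<in> colour_class T c"
    and adj: "p \<in> B" "q \<in> A" and less: "p $ 1 < q $ 1"
  shows False
proof -
  let ?d = "split_depth T p q"
  note ord = above_or_below_ordered[OF less]
  have p: "p \<in> pts T" and q: "q \<in> pts T" and neq: "p \<noteq> q"
    using F less by (auto simp: colour_class_def)
  consider (aa) n n' where "A = above_line T n p" "B = above_line T n' q" "lefts T n p = c" "lefts T n' q = c"
    | (bb) n n' where "A = below_line T n p" "B = below_line T n' q" "rights T n p = Suc c" "rights T n' q = Suc c"
    | (ab) n n' where "A = above_line T n p" "B = below_line T n' q" "lefts T n p = c" "rights T n' q = Suc c"
    | (ba) n n' where "A = below_line T n p" "B = above_line T n' q" "rights T n p = Suc c" "lefts T n' q = c"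
        "initial_lefts T q \<le> n'"
    using F unfolding colour_class_def by blast
  then show False
  proof cases
    case aa
    then have n: "?d < n" "n' \<le> ?d" using ord adj by auto
    have "lefts T n' q = lefts T n' p"
      using lefts_eq_if_le_split_depth[OF T(1) n(2)] by simp
    also have "\<dots> \<le> lefts T ?d p" using n(2) by (rule lefts_mono)
    also have "\<dots> < lefts T n p" using lefts_after_split[OF T(1) p q less n(1)] .
    finally show False using aa by simp
  next
    case bb
    then have n: "n \<le> ?d" "?d < n'" using ord adj by auto
    have "rights T n p = rights T n q"
      using rights_eq_if_le_split_depth[OF T(1) n(1)] .
    also have "\<dots> \<le> rights T ?d q" using n(1) by (rule rights_mono)
    also have "\<dots> < rights T n' q"
      using rights_after_split[OF T(1) q p less, of n'] n(2) by (simp add: split_depth_commute[of T q p])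
    finally show False using bb by simp
  next
    \<comment> \<open>The colour of \<open>A\<close> exceeds \<open>initial_lefts T q\<close>, which
      bounds the colour of \<open>B\<close> from above.\<close>
    case ab
    then have n: "?d < n" using ord adj by auto
    have "initial_lefts T q \<le> lefts T ?d q"
      using initial_lefts_le_split_depth[OF T(1) p q less] by (rule initial_lefts_le_lefts)
    also have "\<dots> = lefts T ?d p"
      using lefts_eq_if_le_split_depth[OF T(1), of ?d p q] by simp
    also have "\<dots> < lefts T n p" using lefts_after_split[OF T(1) p q less n] .
    finally show False using ab rights_XES_tree[OF T(2), of n' q] by simp
  next
    \<comment> \<open>The colour of \<open>A\<close> is less than \<open>initial_lefts T p\<close>,
      which equals \<open>initial_lefts T q\<close> and bounds the colour of \<open>B\<close> from
      below.\<close>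
    case ba
    then have n: "n \<le> ?d" using ord adj by auto
    have "initial_lefts T p < n"
      using rights_eq_0[of n T p] ba(3) by force
    then have "rights T n p \<le> initial_lefts T p" "initial_lefts T q = initial_lefts T p"
      using rights_XES_tree_before_split[OF T(2,1) p q neq, of n] initial_lefts_eq[OF T(1), of p q] n by auto
    moreover have "initial_lefts T q \<le> lefts T n' q"
      using ba(5) by (rule initial_lefts_le_lefts)
    ultimately show False using ba(3,4) by simp
  qed
qed

lemma colour_class_nonadjacent:
  assumes T: "steep T" "XES_tree k k T"
    and F: "(p, A) \<in> colour_class T c" "(q, B) \<in> colour_class T c"
    and adj: "p \<in> B" "q \<in> A"
  shows False
proof -
  have "p \<in> pts T" "q \<in> pts T" "p \<noteq> q"
    using F adj by (auto simp: colour_class_def above_line_def below_line_def)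
  then have "p $ 1 < q $ 1 \<or> q $ 1 < p $ 1"
    using steep_fst_neq[OF T(1)] by (auto simp: neq_iff)
  then show False
    using colour_class_nonadjacent_ordered[OF T] F adj by blast
qed

lemma colour_class_cover:
  assumes T: "steep T" "XES_tree k k T" and p: "p \<in> pts T"
    and C: "C \<in> closed_sets (pts T)" "p \<notin> C"
  shows "\<exists>c<k + 1. \<exists>A. (p, A) \<in> colour_class T c \<and> C \<subseteq> A"
proof -
  have above_case: ?thesis if "C \<subseteq> above_line T n p" for n
  proof -
    \<comment> \<open>Points left of \<open>p\<close> split off no earlier than
      \<open>initial_lefts T p\<close>, so raising the threshold loses none of them.\<close>
    let ?m = "max n (initial_lefts T p)"
    have "C \<subseteq> above_line T ?m p"
    proof
      fix q assume "q \<in> C"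
      then have q: "q \<in> pts T - {p}" "p $ 1 < q $ 1 \<longleftrightarrow> split_depth T p q < n"
        using that by (auto simp: above_line_def)
      have "initial_lefts T p \<le> split_depth T p q" if "\<not> p $ 1 < q $ 1"
        using initial_lefts_le_split_depth[OF T(1), of q p] steep_fst_neq[OF T(1) p, of q] that q(1) p
        by (auto simp: split_depth_commute[of T q p])
      then show "q \<in> above_line T ?m p" using q by (auto simp: above_line_def)
    qed
    moreover have "(p, above_line T ?m p) \<in> colour_class T (lefts T ?m p)"
      using p unfolding colour_class_def by (intro UnI1) auto
    moreover have "lefts T ?m p < k + 1"
      using lefts_XES_tree[OF T(2), of ?m p] by simp
    ultimately show ?thesis by blast
  qed
  obtain n where "C \<subseteq> above_line T n p \<or> C \<subseteq> below_line T n p"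
    using closed_subset_above_or_below[OF T(1) p C] by blast
  then show ?thesis
  proof
    assume below: "C \<subseteq> below_line T n p"
    show ?thesis
    proof (cases "rights T n p")
      case 0
      \<comment> \<open>With no right turn in the first \<open>n\<close> steps, nothing to the left
        of \<open>p\<close> splits off before depth \<open>n\<close>. So \<open>C\<close> lies to
        the right, and a threshold beyond all depths captures everything there.\<close>
      have "C \<subseteq> above_line T (size T + 1) p"
      proof
        fix q assume "q \<in> C"
        then have q: "q \<in> pts T - {p}" "p $ 1 < q $ 1 \<longleftrightarrow> n \<le> split_depth T p q"
          using below by (auto simp: below_line_def)
        have "p $ 1 < q $ 1"
        proof (rule ccontr)
          assume "\<not> p $ 1 < q $ 1"
          then have "q $ 1 < p $ 1" "split_depth T p q < n"
            using q steep_fst_neq[OF T(1) p, of q] by auto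
          then show False
            using rights_after_split[OF T(1) p, of q n] q 0 by auto
        qed
        then show "q \<in> above_line T (size T + 1) p"
          using q split_depth_less_size[of T p q] by (auto simp: above_line_def)
      qed
      then show ?thesis by (rule above_case)
    next
      case (Suc c)
      have "initial_lefts T p \<le> lefts T (size T + 1) p"
        using initial_lefts_less_size[of T p] by (intro initial_lefts_le_lefts) simp
      also have "\<dots> \<le> k" by (rule lefts_XES_tree[OF T(2)])
      finally have "c < k + 1"
        using rights_XES_tree[OF T(2), of n p] Suc by simp
      moreover have "(p, below_line T n p) \<in> colour_class T c"
        using p Suc unfolding colour_class_def by (intro UnI2) auto
      ultimately show ?thesis using below by blast
    qed
  qed (rule above_case)
qed

lemma geom_dim_XES_tree:
  assumes T: "steep T" "XES_tree k k T"
  shows "geom_dim (pts T) = k + 1"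
  unfolding geom_dim_def order_dimension_def
proof (rule Least_equality, intro conjI)
  show "\<exists>s. (\<forall>i<k + 1. linear_extension (closed_sets (pts T)) (closed_order (pts T)) (s i)) \<and>
    closed_order (pts T) = (\<Inter>i<k + 1. s i)"
  proof (rule geom_dim_realizer[where F = "colour_class T"])
    fix c
    have inv: "split_invariant T p A" if "(p, A) \<in> colour_class T c" "p \<in> pts T" for p A
      using that by (elim colour_class_cases) (simp_all add: T split_invariant_above split_invariant_below)
    have "\<exists>\<rho>::real^2 \<Rightarrow> nat. \<forall>(p, A)\<in>colour_class T c. p \<in> pts T \<longrightarrow> (\<forall>q\<in>A \<inter> pts T. \<rho> q < \<rho> p)"
    proof (rule rank_exists[OF T(1)])
      fix p A assume "(p, A) \<in> colour_class T c" "p \<in> pts T"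
      then show "split_invariant T p A" by (rule inv)
    next
      fix p A q B assume "(p, A) \<in> colour_class T c" "(q, B) \<in> colour_class T c" "p \<in> B" "q \<in> A"
      then show False by (rule colour_class_nonadjacent[OF T])
    qed
    then obtain \<rho> :: "real^2 \<Rightarrow> nat" where
      \<rho>: "\<forall>(p, A)\<in>colour_class T c. p \<in> pts T \<longrightarrow> (\<forall>q\<in>A \<inter> pts T. \<rho> q < \<rho> p)"
      by blast
    have "p \<in> pts T" "A \<subseteq> pts T" if "(p, A) \<in> colour_class T c" for p A
      using that by (elim colour_class_cases; auto simp: above_line_def below_line_def)+
    then show "\<exists>\<rho>::real^2 \<Rightarrow> nat. \<forall>(p, A)\<in>colour_class T c. \<forall>q\<in>A. \<rho> q < \<rho> p"
      using \<rho> by (intro exI[of _ \<rho>]) blast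
  next
    fix c p A assume "(p, A) \<in> colour_class T c"
    then show "A \<in> closed_sets (pts T)"
      by (elim colour_class_cases) (simp_all add: T above_closed below_closed)
  qed (use colour_class_cover[OF T] in auto)
next
  fix t :: nat assume t: "t > 0 \<and> (\<exists>s. (\<forall>i<t. linear_extension (closed_sets (pts T)) (closed_order (pts T)) (s i)) \<and>
    closed_order (pts T) = (\<Inter>i<t. s i))"
  obtain Q where Q: "Q \<subseteq> pts T" "card Q = Suc k" "\<And>p q. p \<in> Q \<Longrightarrow> q \<in> Q \<Longrightarrow> p $ 1 < q $ 1 \<Longrightarrow>
        split_depth T p q = initial_lefts T q \<and> initial_lefts T q < initial_lefts T p"
    using XES_tree_transversal[OF T(2,1)] by blast
  \<comment> \<open>Seen from \<open>p\<close>, chosen points to the right split off before depth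
    \<open>initial_lefts T p\<close> and those to the left exactly at it, so this threshold has them
    all above the line.\<close>
  have separate: "\<exists>A\<in>closed_sets (pts T). p \<notin> A \<and> Q - {p} \<subseteq> A" if p: "p \<in> Q" for p
  proof (rule bexI, intro conjI)
    show "above_line T (initial_lefts T p) p \<in> closed_sets (pts T)"
      using above_closed[OF T(1)] p Q(1) by auto
    show "p \<notin> above_line T (initial_lefts T p) p" by (auto simp: above_line_def)
    show "Q - {p} \<subseteq> above_line T (initial_lefts T p) p"
    proof
      fix q assume q: "q \<in> Q - {p}"
      then have "p $ 1 < q $ 1 \<or> q $ 1 < p $ 1"
        using steep_fst_neq[OF T(1), of p q] p Q(1) by (auto simp: neq_iff)
      then show "q \<in> above_line T (initial_lefts T p) p"
        using Q(3)[of p q] Q(3)[of q p] Q(1) p q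
        by (auto simp: above_line_def split_depth_commute[of T q p])
    qed
  qed
  obtain s where "\<forall>i<t. linear_extension (closed_sets (pts T)) (closed_order (pts T)) (s i)"
    and s: "closed_order (pts T) = (\<Inter>i<t. s i)"
    using t by blast
  then have "linear_extension (closed_sets (pts T)) (closed_order (pts T)) (s i)" if "i < t" for i
    using that by blast
  from card_le_realizer_size[OF Q(1) separate this s] show "k + 1 \<le> t"
    using Q(2) by simp
qed simp

section \<open>Minimal cycles\<close>

text \<open>By maximality of copoints, inclusion in a half-plane set is equality.\<close>

lemma copoint_above_or_below:
  assumes "steep T" "A \<in> copoints (pts T)"
  obtains n where "A = above_line T n (attach_point (pts T) A) \<or> A = below_line T n (attach_point (pts T) A)"
proof -
  let ?p = "attach_point (pts T) A"
  have p: "?p \<in> pts T" using attach_point_in[OF assms(2)] .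
  obtain n where n: "A \<subseteq> above_line T n ?p \<or> A \<subseteq> below_line T n ?p"
    using closed_subset_above_or_below[OF assms(1) p copointD(1,2)[OF assms(2)]] by blast
  have "A = B" if "B \<in> closed_sets (pts T)" "?p \<notin> B" "A \<subseteq> B" for B
    using attach_point_in_superset[OF finite_pts assms(2) that(1)] that by auto
  moreover have "?p \<notin> above_line T n ?p" "?p \<notin> below_line T n ?p"
    by (auto simp: above_line_def below_line_def)
  ultimately show thesis
    using that n above_closed[OF assms(1) p] below_closed[OF assms(1) p] by metis
qed

lemma split_invariant_copoint:
  "steep T \<Longrightarrow> A \<in> copoints (pts T) \<Longrightarrow> split_invariant T (attach_point (pts T) A) A"
  by (metis copoint_above_or_below attach_point_in split_invariant_above split_invariant_below)

lemma walk_decreasing: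
  fixes h :: "'a \<Rightarrow> nat"
  assumes "pre_digraph.cas (with_proj G) u p v" "p \<noteq> []" "\<And>x y. (x, y) \<in> set p \<Longrightarrow> h y < h x"
  shows "h v < h u"
  using assms unfolding cas_with_proj_eq
proof (induction p arbitrary: u)
  case (Cons e p)
  obtain y where e: "e = (u, y)" "pcas y p v"
    using Cons.prems(1) by (cases e) auto
  have uy: "h y < h u" using Cons.prems(3)[of u y] e(1) by simp
  show ?case
  proof (cases "p = []")
    case True
    then show ?thesis using e(2) uy by simp
  next
    case False
    have "h v < h y"
      by (rule Cons.IH[OF e(2) False]) (simp add: Cons.prems(3))
    then show ?thesis using uy by simp
  qed
qed auto

section \<open>Cycles of the critical digraph\<close>

context
  fixes T :: "(real^2) btree"
  assumes steep: "steep T" and two: "card (pts T) \<ge> 2"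
begin

abbreviation crit_digraph where
  "crit_digraph \<equiv> critical_digraph (closed_sets (pts T)) (closed_order (pts T))"

abbreviation crit_pair where
  "crit_pair A \<equiv> ({attach_point (pts T) A}, A)"

lemmas crit_pairs = critical_pairs_closed_sets[OF finite_pts two]

lemma crit_arcs:
  "(x, y) \<in> parcs crit_digraph \<longleftrightarrow> (\<exists>A\<in>copoints (pts T). \<exists>B\<in>copoints (pts T).
     x = crit_pair A \<and> y = crit_pair B \<and> attach_point (pts T) B \<in> A)"
proof -
  have "(x, y) \<in> parcs crit_digraph \<longleftrightarrow> x \<in> crit_pair ` copoints (pts T) \<and> y \<in> crit_pair ` copoints (pts T) \<and>
      (fst y, snd x) \<in> closed_order (pts T)"
    unfolding crit_pairs[symmetric] by (cases x; cases y) (auto simp: critical_digraph_def)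
  then show ?thesis
    by (auto simp: closed_order_def copointD(1) attach_point_in singleton_closed)
qed

text \<open>If no two copoints on the cycle were adjacent, the ranks of their attachment points
  would drop along every arc, which is impossible on a closed walk.\<close>

lemma cycle_contains_two_cycle:
  assumes "S \<in> cycle_vertex_sets crit_digraph"
  obtains A B where "A \<in> copoints (pts T)" "B \<in> copoints (pts T)" "crit_pair A \<in> S" "crit_pair B \<in> S"
    "attach_point (pts T) A \<in> B" "attach_point (pts T) B \<in> A"
proof (rule ccontr)
  assume no: "\<not> thesis"
  obtain u p where S: "S = fst ` set p" and p: "p \<noteq> []" "set p \<subseteq> parcs crit_digraph"
    "pre_digraph.cas (with_proj crit_digraph) u p u"
    using assms unfolding cycle_vertex_sets_def pre_digraph.cycle_def pre_digraph.awalk_def by auto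
  define F where "F = (\<lambda>A. (attach_point (pts T) A, A)) ` {A \<in> copoints (pts T). crit_pair A \<in> S}"
  have "\<exists>\<rho>::real^2 \<Rightarrow> nat. \<forall>(p, A)\<in>F. p \<in> pts T \<longrightarrow> (\<forall>q\<in>A \<inter> pts T. \<rho> q < \<rho> p)"
    using split_invariant_copoint[OF steep] that no by (intro rank_exists steep) (auto simp: F_def)
  then obtain \<rho> :: "real^2 \<Rightarrow> nat" where
    \<rho>F: "\<forall>(p, A)\<in>F. p \<in> pts T \<longrightarrow> (\<forall>q\<in>A \<inter> pts T. \<rho> q < \<rho> p)"
    by blast
  have \<rho>: "\<rho> q < \<rho> (attach_point (pts T) A)"
    if "A \<in> copoints (pts T)" "crit_pair A \<in> S" "q \<in> A" "q \<in> pts T" for A q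
  proof -
    have "(attach_point (pts T) A, A) \<in> F" using that(1,2) by (simp add: F_def)
    then show ?thesis using \<rho>F attach_point_in[OF that(1)] that(3,4) by blast
  qed
  let ?h = "\<lambda>x::(real^2) set \<times> (real^2) set. \<rho> (attach_point (pts T) (snd x))"
  have "?h y < ?h x" if xy: "(x, y) \<in> set p" for x y
  proof -
    obtain A B where AB: "A \<in> copoints (pts T)" "B \<in> copoints (pts T)" "x = crit_pair A" "y = crit_pair B"
      "attach_point (pts T) B \<in> A"
      using p(2) xy crit_arcs by blast
    have "x \<in> S" using xy S by force
    then show ?thesis using \<rho>[OF AB(1) _ AB(5) attach_point_in[OF AB(2)]] AB by auto
  qed
  from walk_decreasing[OF p(3,1), of ?h, OF this] show False by simp
qed

lemma two_cycle:
  assumes "A \<in> copoints (pts T)" "B \<in> copoints (pts T)" "attach_point (pts T) A \<in> B" "attach_point (pts T) B \<in> A"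
  shows "{crit_pair A, crit_pair B} \<in> cycle_vertex_sets crit_digraph"
proof -
  let ?p = "[(crit_pair A, crit_pair B), (crit_pair B, crit_pair A)]"
  have "A \<noteq> B" using copointD(2)[OF assms(1)] assms(3) by auto
  have "(crit_pair A, crit_pair B) \<in> parcs crit_digraph" "(crit_pair B, crit_pair A) \<in> parcs crit_digraph"
    unfolding crit_arcs using assms by blast+
  moreover have "crit_pair A \<in> pverts crit_digraph"
    using assms(1) by (simp add: critical_digraph_def crit_pairs)
  ultimately have "pre_digraph.cycle (with_proj crit_digraph) ?p"
    using \<open>A \<noteq> B\<close>
    by (auto simp: pre_digraph.cycle_def pre_digraph.awalk_def cas_with_proj_eq awalk_verts_with_proj_eq
        simp del: insert_iff intro!: exI[of _ "crit_pair A"])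
  moreover have "fst ` set ?p = {crit_pair A, crit_pair B}" by simp
  ultimately show ?thesis unfolding cycle_vertex_sets_def by blast
qed

text \<open>Every cycle contains the vertices of a two-cycle, so minimal ones are two-cycles.
  Conversely, a proper subset of a two-cycle has too few vertices, as no copoint is adjacent to
  itself.\<close>

lemma minimal_cycles:
  "minimal_cycle_vertex_sets crit_digraph = {{crit_pair A, crit_pair B} | A B.
     A \<in> copoints (pts T) \<and> B \<in> copoints (pts T) \<and> attach_point (pts T) A \<in> B \<and> attach_point (pts T) B \<in> A}"
  (is "_ = ?E")
proof (intro equalityI subsetI)
  fix S assume "S \<in> minimal_cycle_vertex_sets crit_digraph"
  then have S: "S \<in> cycle_vertex_sets crit_digraph" "\<And>S'. S' \<in> cycle_vertex_sets crit_digraph \<Longrightarrow> \<not> S' \<subset> S"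
    by (auto simp: minimal_cycle_vertex_sets_def)
  obtain A B where AB: "A \<in> copoints (pts T)" "B \<in> copoints (pts T)" "crit_pair A \<in> S" "crit_pair B \<in> S"
    "attach_point (pts T) A \<in> B" "attach_point (pts T) B \<in> A"
    using S(1) by (rule cycle_contains_two_cycle)
  then have "S = {crit_pair A, crit_pair B}"
    using S(2)[OF two_cycle[of A B]] by auto
  then show "S \<in> ?E" using AB by blast
next
  fix S assume "S \<in> ?E"
  then obtain A B where AB: "A \<in> copoints (pts T)" "B \<in> copoints (pts T)" "S = {crit_pair A, crit_pair B}"
    "attach_point (pts T) A \<in> B" "attach_point (pts T) B \<in> A"
    by blast
  have "\<not> S' \<subset> S" if S': "S' \<in> cycle_vertex_sets crit_digraph" for S'
  proof
    assume sub: "S' \<subset> S"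
    obtain C D where CD: "C \<in> copoints (pts T)" "D \<in> copoints (pts T)" "crit_pair C \<in> S'" "crit_pair D \<in> S'"
      "attach_point (pts T) C \<in> D"
      using S' by (rule cycle_contains_two_cycle)
    then have "C \<noteq> D" using copointD(2) by auto
    moreover have "C = A \<or> C = B" "D = A \<or> D = B" using sub CD AB(3) by blast+
    ultimately have "S \<subseteq> S'" using CD AB(3) by auto
    then show False using sub by auto
  qed
  then show "S \<in> minimal_cycle_vertex_sets crit_digraph"
    using two_cycle[of A B] AB by (auto simp: minimal_cycle_vertex_sets_def)
qed

lemma critical_hypergraph_iso_copoint_graph:
  "hypergraph_iso (critical_hypergraph (pts T)) (copoint_graph (pts T))"
  unfolding hypergraph_iso_def critical_hypergraph_def copoint_graph_def fst_conv snd_conv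
proof (intro exI conjI)
  \<comment> \<open>The isomorphism drops the singleton, which the copoint determines.\<close>
  show "bij_betw snd (critical_pairs (closed_sets (pts T)) (closed_order (pts T))) (copoints (pts T))"
    unfolding crit_pairs bij_betw_def by (force simp: inj_on_def)
  show "(`) snd ` minimal_cycle_vertex_sets crit_digraph =
    {{A, B} | A B. A \<in> copoints (pts T) \<and> B \<in> copoints (pts T) \<and> A \<noteq> B \<and>
       attach_point (pts T) A \<in> B \<and> attach_point (pts T) B \<in> A}" (is "_ ` ?C = ?E")
  proof (intro equalityI subsetI)
    fix e assume "e \<in> (`) snd ` ?C"
    then obtain A B where AB: "e = snd ` {crit_pair A, crit_pair B}" "A \<in> copoints (pts T)" "B \<in> copoints (pts T)"
      "attach_point (pts T) A \<in> B" "attach_point (pts T) B \<in> A"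
      unfolding minimal_cycles by blast
    moreover have "A \<noteq> B" using copointD(2)[OF AB(2)] AB(4) by blast
    moreover have "e = {A, B}" using AB(1) by simp
    ultimately show "e \<in> ?E" by blast
  next
    fix e assume "e \<in> ?E"
    then obtain A B where AB: "e = {A, B}" "A \<in> copoints (pts T)" "B \<in> copoints (pts T)"
      "attach_point (pts T) A \<in> B" "attach_point (pts T) B \<in> A"
      by blast
    then have "{crit_pair A, crit_pair B} \<in> ?C"
      unfolding minimal_cycles by blast
    moreover have "e = snd ` {crit_pair A, crit_pair B}" using AB(1) by simp
    ultimately show "e \<in> (`) snd ` ?C" by (rule rev_image_eqI)
  qed
qed

end

theorem corollary4p4:
  fixes k :: nat and X :: "(real^2) set"
  assumes "k > 0" and "is_XES k X"
  shows "hypergraph_iso (critical_hypergraph X) (copoint_graph X) \<and> geom_dim X = k + 1"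
proof -
  obtain T where T: "XES_tree k k T" "steep T" "pts T = X"
    using is_XES_upto_tree assms(2) unfolding is_XES_def by blast
  obtain Q where "Q \<subseteq> pts T" "card Q = Suc k"
    using XES_tree_transversal[OF T(1,2)] by blast
  \<comment> \<open>Here \<open>k > 0\<close> enters, securing the two points that the description
    of critical pairs requires.\<close>
  then have "card (pts T) \<ge> 2"
    using card_mono[of "pts T" Q] assms(1) by simp
  then show ?thesis
    using critical_hypergraph_iso_copoint_graph[OF T(2)] geom_dim_XES_tree[OF T(2,1)] T(3) by auto
qed

end
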